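(* An affine permutation in $\widetilde S_n$ is uniquely sorted if and only if it is in the image of $\widetilde{\mathtt s}$ and has exactly $\frac n2$ descents. In particular, there are no uniquely sorted affine permutations in $\widetilde S_n$ when $n$ is odd.
   Context: An affine permutation of size $n$ is a bijection $w:\mathbb Z\to\mathbb Z$ with $w(i+n)=w(i)+n$ for all $i\in\mathbb Z$ and $\sum_{i=1}^n w(i)=\binom{n+1}{2}$. They form the affine symmetric group $\widetilde S_n$ under composition, a Coxeter group of type $\widetilde A_{n-1}$ with simple generators $\widetilde s_1,\ldots,\widetilde s_n$, where $\widetilde s_i$ swaps $i+mn$ and $i+mn+1$ for all $m\in\mathbb Z$ and fixes all other integers. The descents of $w$ meant here are its right descents, i.e. the simple generators $\widetilde s_i$, $1\le i\le n$, with $w(i)>w(i+1)$. The left weak order is $x\leq_L y\iff\ell(yx^{-1})=\ell(y)-\ell(x)$, $\ell$ being Coxeter length; $e$ is the identity. Affine sylvester congruence. For $w\in\widetilde S_n$ define a partial order $\preceq_w$ on $\mathbb Z$ (positions): for $i<j$, the positions $i,j$ are incomparable if and only if there is $k$ with $i<k<j$ and $w(k)>\max\{w(i),w(j)\}$; otherwise the position with the smaller value of $w$ is below the other. (This is the descendant order of the decreasing affine binary plane tree with in-order reading $w$.) The affine sylvester congruence is $v\equiv_{\widetilde{\mathrm{syl}}}w\iff{\preceq_v}={\preceq_w}$; it is a semilattice congruence on $(\widetilde S_n,\leq_L)$ in which $\{e\}$ is a class, and each class has a unique $\leq_L$-minimal element. Let $\pi_\downarrow(w)$ be the minimal element of the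 class of $w$. The affine stack-sorting map is $\widetilde{\mathtt s}:\widetilde S_n\to\widetilde S_n$, $\widetilde{\mathtt s}(w)=w\,(\pi_\downarrow(w))^{-1}$. The fertility of $w\in\widetilde S_n$ is $\lvert\widetilde{\mathtt s}^{-1}(w)\rvert$ (which is finite), and $w$ is uniquely sorted if its fertility is $1$. *)

theory Defs
  imports Complex_Main
begin

definition affine_perms :: "nat \<Rightarrow> (int \<Rightarrow> int) set" where
  "affine_perms n = {w. bij w \<and> (\<forall>i. w (i + int n) = w i + int n) \<and>
     (\<Sum>i = 1..int n. w i) = int ((n + 1) choose 2)}"

text \<open>The simple generator with index \<open>i\<close>. It is the intended involution only for \<open>n \<ge> 2\<close>;
  for \<open>n = 1\<close> the two congruence conditions overlap.\<close>

definition affine_simple :: "nat \<Rightarrow> int \<Rightarrow> int \<Rightarrow> int" where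
  "affine_simple n i j =
     (if int n dvd j - i then j + 1 else if int n dvd j - (i + 1) then j - 1 else j)"

definition affine_word :: "nat \<Rightarrow> int list \<Rightarrow> int \<Rightarrow> int" where
  "affine_word n is = foldr (\<circ>) (map (affine_simple n) is) id"

definition affine_length :: "nat \<Rightarrow> (int \<Rightarrow> int) \<Rightarrow> nat" where
  "affine_length n w =
     (LEAST k. \<exists>is. set is \<subseteq> {1..int n} \<and> length is = k \<and> affine_word n is = w)"

definition descents :: "nat \<Rightarrow> (int \<Rightarrow> int) \<Rightarrow> (int \<Rightarrow> int) set" where
  "descents n w = {affine_simple n i | i. i \<in> {1..int n} \<and> w i > w (i + 1)}"

text \<open>The difference of lengths is taken in the integers, to avoid truncation.\<close>

definition left_weak_le :: "nat \<Rightarrow> (int \<Rightarrow> int) \<Rightarrow> (int \<Rightarrow> int) \<Rightarrow> bool" where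
  "left_weak_le n x y \<longleftrightarrow>
     int (affine_length n (y \<circ> inv x)) = int (affine_length n y) - int (affine_length n x)"

text \<open>The (reflexive) order on positions attached to \<open>w\<close>, i.e. the descendant order of the
  decreasing binary plane tree with in-order reading \<open>w\<close>.\<close>

definition tree_incomparable :: "(int \<Rightarrow> int) \<Rightarrow> int \<Rightarrow> int \<Rightarrow> bool" where
  "tree_incomparable w i j \<longleftrightarrow>
     (\<exists>k. min i j < k \<and> k < max i j \<and> w k > max (w i) (w j))"

definition tree_le :: "(int \<Rightarrow> int) \<Rightarrow> int \<Rightarrow> int \<Rightarrow> bool" where
  "tree_le w i j \<longleftrightarrow> \<not> tree_incomparable w i j \<and> w i \<le> w j"

definition sylvester_congruent :: "(int \<Rightarrow> int) \<Rightarrow> (int \<Rightarrow> int) \<Rightarrow> bool" where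
  "sylvester_congruent v w \<longleftrightarrow> tree_le v = tree_le w"

definition sylvester_class :: "nat \<Rightarrow> (int \<Rightarrow> int) \<Rightarrow> (int \<Rightarrow> int) set" where
  "sylvester_class n w = {v \<in> affine_perms n. sylvester_congruent v w}"

definition pi_down :: "nat \<Rightarrow> (int \<Rightarrow> int) \<Rightarrow> int \<Rightarrow> int" where
  "pi_down n w = (THE u. u \<in> sylvester_class n w \<and>
     (\<forall>v \<in> sylvester_class n w. left_weak_le n v u \<longrightarrow> v = u))"

definition affine_stack_sort :: "nat \<Rightarrow> (int \<Rightarrow> int) \<Rightarrow> int \<Rightarrow> int" where
  "affine_stack_sort n w = w \<circ> inv (pi_down n w)"

definition fertility :: "nat \<Rightarrow> (int \<Rightarrow> int) \<Rightarrow> nat" where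
  "fertility n w = card {v \<in> affine_perms n. affine_stack_sort n v = w}"

definition uniquely_sorted :: "nat \<Rightarrow> (int \<Rightarrow> int) \<Rightarrow> bool" where
  "uniquely_sorted n w \<longleftrightarrow> fertility n w = 1"

end

theory Submission
  imports Defs
begin

text \<open>Since \<open>\<pi>\<^sub>\<down>(v)\<close> is the postorder numbering of the decreasing tree of \<open>v\<close>, the sorted
  permutation lists the values of \<open>v\<close> in postorder. A descent of this list can only end in the
  value at a valley of \<open>v\<close>, and two valleys are never adjacent, so there are at most \<open>n / 2\<close> descents.

  In the case of equality \<open>v\<close> alternates and its valleys are numbered, in increasing order, exactly
  by the ends of descents. Each peak is then numbered by matching parentheses: its number is where the
  valleys and peaks listed since the adjacent valley first balance. Hence \<open>v\<close> is determined.

  Otherwise \<open>v\<close> has a double ascent, a double descent, or a valley that is not the end of a descent.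
  In each case an element can be moved, within \<open>v\<close>, across a smaller element and the right
  subtree of that element without changing the postorder reading, which gives a second preimage.\<close>

section \<open>Affine permutations\<close>

text \<open>The postorder description of \<open>pi_down\<close> has to be extracted from a
  definition by Coxeter length. Left multiplication by a generator exchanges adjacent values, so
  length counts inversions of positions, and a class member with fewest inversions has only those
  that the tree forces: an ancestor to the left of its descendant. This settles the relative order
  of the values of \<open>pi_down\<close>, and the normalised sum then leaves no freedom of
  translation.

  The words are infinite in both directions, so there is no first letter at which an induction or a
  parenthesis matching could start. A second preimage is therefore produced by rotating a window and
  all its translates at once, where periodicity guarantees that the window is shorter than a period.
  In the extremal case the valleys of two preimages are two-sided enumerations of the same set of
  numbers; they agree only up to a shift of positions, and the sum condition shows at the very end
  that this shift is zero.\<close>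

lemma affine_perms_bij: "w \<in> affine_perms n \<Longrightarrow> bij w"
  by (simp add: affine_perms_def)

lemma affine_perms_inj: "w \<in> affine_perms n \<Longrightarrow> w x = w y \<longleftrightarrow> x = y"
  by (meson affine_perms_bij bij_is_inj inj_eq)

lemma affine_perms_inv [simp]:
  assumes "w \<in> affine_perms n"
  shows "w (inv w x) = x" "inv w (w x) = x"
  using affine_perms_bij[OF assms] by (simp_all add: bij_is_surj surj_f_inv_f bij_is_inj)

lemma shift_mult:
  fixes w :: "int \<Rightarrow> int"
  assumes "\<And>i. w (i + n) = w i + n"
  shows "w (i + m * n) = w i + m * n"
proof (induction m rule: int_induct[where k = 0])
  case (step1 m)
  then show ?case using assms[of "i + m * n"] by (simp add: algebra_simps)
next
  case (step2 m)
  then show ?case using assms[of "i + (m - 1) * n"] by (simp add: algebra_simps)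
qed simp

lemma affine_perms_shift:
  assumes "w \<in> affine_perms n"
  shows "w (i + m * int n) = w i + m * int n"
  by (rule shift_mult) (use assms in \<open>simp add: affine_perms_def\<close>)

lemma dvd_diff_shift:
  fixes x y d :: int
  assumes "d dvd x - y"
  shows "\<exists>m. x = y + m * d"
proof -
  obtain m where "x - y = d * m" using assms by blast
  then show ?thesis by (intro exI[of _ m]) (simp add: algebra_simps)
qed

lemma affine_perms_dvd:
  assumes "w \<in> affine_perms n"
  shows "int n dvd w x - w y \<longleftrightarrow> int n dvd x - y"
proof
  assume "int n dvd x - y"
  then obtain m where "x = y + m * int n" using dvd_diff_shift by blast
  then show "int n dvd w x - w y" using affine_perms_shift[OF assms, of y m] by simp
next
  assume "int n dvd w x - w y"
  then obtain m where "w x = w y + m * int n" using dvd_diff_shift by blast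
  then have "w x = w (y + m * int n)" using affine_perms_shift[OF assms, of y m] by simp
  then have "x = y + m * int n" using affine_perms_inj[OF assms] by simp
  then show "int n dvd x - y" by simp
qed

section \<open>Complete residue systems and sums over a period\<close>

lemma shift_into_period:
  assumes "n > 0"
  shows "\<exists>m. x + m * int n \<in> {1..int n}"
proof
  have "x + - ((x - 1) div int n) * int n = (x - 1) mod int n + 1"
    by (simp add: algebra_simps minus_div_mult_eq_mod [symmetric])
  then show "x + - ((x - 1) div int n) * int n \<in> {1..int n}"
    using assms pos_mod_bound[of "int n" "x - 1"] pos_mod_sign[of "int n" "x - 1"]
    unfolding atLeastAtMost_iff by linarith
qed

text \<open>Congruent values come from congruent arguments, because a multiple of \<open>n\<close>
  can be pulled inside \<open>f\<close>. This gives injectivity between two sets of size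
  \<open>n\<close>.\<close>

lemma bij_betw_residues:
  fixes f :: "int \<Rightarrow> int"
  assumes "n > 0" "inj f" "\<And>i. f (i + int n) = f i + int n"
  shows "bij_betw (\<lambda>i. f i mod int n) {1..int n} {0..<int n}"
proof -
  have inj: "inj_on (\<lambda>i. f i mod int n) {1..int n}"
  proof (rule inj_onI)
    fix i j assume ij: "i \<in> {1..int n}" "j \<in> {1..int n}" "f i mod int n = f j mod int n"
    then have "int n dvd f i - f j" by (simp add: mod_eq_dvd_iff)
    then obtain m where "f i = f j + m * int n" using dvd_diff_shift by blast
    then have "i = j + m * int n"
      using shift_mult[of f "int n" j m] assms(2,3) by (metis injD)
    then have "int n dvd i - j" by simp
    then show "i = j" using ij(1,2) zdvd_not_zless[of "i - j" "int n"] zdvd_not_zless[of "j - i" "int n"]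
      by (cases i j rule: linorder_cases) (auto simp: dvd_diff_commute)
  qed
  moreover have "(\<lambda>i. f i mod int n) ` {1..int n} = {0..<int n}"
    by (rule card_subset_eq) (use assms(1) in \<open>auto simp: card_image[OF inj]\<close>)
  ultimately show ?thesis by (simp add: bij_betw_def)
qed

lemma sum_periodic:
  fixes d f :: "int \<Rightarrow> int"
  assumes "n > 0" "inj f" "\<And>i. f (i + int n) = f i + int n" "\<And>i. d (i + int n) = d i"
  shows "(\<Sum>i=1..int n. d (f i)) = (\<Sum>i=1..int n. d i)"
proof -
  have d: "d x = d (x mod int n)" for x
  proof -
    \<comment> \<open>Adding the identity turns the periodic \<open>d\<close> into a map that
      commutes with the shift, so that \<open>shift_mult\<close> applies to it.\<close>
    have "(\<lambda>x. d x + x) (x mod int n + (x div int n) * int n) = d (x mod int n) + x mod int n + (x div int n) * int n"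
      by (rule shift_mult) (simp add: assms(4))
    then show ?thesis by simp
  qed
  have *: "(\<Sum>i=1..int n. d (g i)) = (\<Sum>i\<in>{0..<int n}. d i)"
    if "inj g" "\<And>i. g (i + int n) = g i + int n" for g
    using sum.reindex_bij_betw[OF bij_betw_residues[OF assms(1) that], of d] d by simp
  show ?thesis using *[OF assms(2,3)] *[of "\<lambda>x. x"] by simp
qed

lemma bij_if_inj_shift:
  fixes f :: "int \<Rightarrow> int"
  assumes "n > 0" "inj f" "\<And>i. f (i + int n) = f i + int n"
  shows "bij f"
proof -
  have "\<exists>x. f x = y" for y
  proof -
    have "y mod int n \<in> (\<lambda>i. f i mod int n) ` {1..int n}"
      using bij_betw_residues[OF assms] assms(1) by (auto simp: bij_betw_def)
    then obtain i where "y mod int n = f i mod int n" by blast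
    then have "int n dvd y - f i" by (simp add: mod_eq_dvd_iff)
    then obtain m where "y = f i + m * int n" using dvd_diff_shift by blast
    then show ?thesis using shift_mult[of f "int n" i m] assms(3) by metis
  qed
  then show ?thesis using assms(2) by (metis bijI surjI)
qed

lemma sum_upto_int: "(\<Sum>i=1..int n. i) = int ((n + 1) choose 2)"
proof (induction n)
  case (Suc n)
  have "{1..int (Suc n)} = insert (int (Suc n)) {1..int n}" by auto
  then show ?case using Suc by (simp add: numeral_2_eq_2)
qed simp

lemma affine_permsI:
  assumes "n > 0" "inj f" "\<And>i. f (i + int n) = f i + int n" "(\<Sum>i=1..int n. f i - i) = 0"
  shows "f \<in> affine_perms n"
  using assms bij_if_inj_shift[OF assms(1-3)] sum_upto_int[of n]
  by (simp add: affine_perms_def sum_subtractf)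

lemma affine_perms_sum:
  assumes "w \<in> affine_perms n"
  shows "(\<Sum>i=1..int n. w i - i) = 0"
  using assms sum_upto_int[of n] by (simp add: affine_perms_def sum_subtractf)

lemma affine_perms_shift1: "w \<in> affine_perms n \<Longrightarrow> w (i + int n) = w i + int n"
  by (simp add: affine_perms_def)

text \<open>The displacement of \<open>w\<close> is periodic and \<open>f\<close> runs through a
  complete residue system, so this is the normalisation of \<open>w\<close> again. It serves with
  \<open>f\<close> an affine permutation, an inverse, or a plain translation.\<close>

lemma sum_displacement:
  assumes "n > 0" "w \<in> affine_perms n" "inj f" "\<And>i. f (i + int n) = f i + int n"
  shows "(\<Sum>i=1..int n. w (f i) - f i) = 0"
  using sum_periodic[of n f "\<lambda>x. w x - x"] assms affine_perms_sum[OF assms(2)]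
  by (simp add: affine_perms_shift1)

lemma affine_perms_comp:
  assumes "n > 0" "v \<in> affine_perms n" "w \<in> affine_perms n"
  shows "v \<circ> w \<in> affine_perms n"
proof (rule affine_permsI)
  show "inj (v \<circ> w)" using assms by (simp add: affine_perms_bij bij_is_inj inj_compose)
  have "(\<Sum>i=1..int n. v (w i) - w i) = 0"
    by (rule sum_displacement) (use assms in \<open>simp_all add: affine_perms_bij bij_is_inj affine_perms_shift1\<close>)
  then show "(\<Sum>i=1..int n. (v \<circ> w) i - i) = 0"
    using affine_perms_sum[OF assms(3)] by (simp add: sum_subtractf)
qed (use assms in \<open>simp_all add: affine_perms_shift1\<close>)

lemma affine_perms_inverse:
  assumes "n > 0" "w \<in> affine_perms n"
  shows "inv w \<in> affine_perms n"
proof -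
  have inj: "inj (inv w)" by (simp add: affine_perms_bij[OF assms(2)] bij_imp_bij_inv bij_is_inj)
  have sh: "inv w (i + int n) = inv w i + int n" for i
    using affine_perms_shift1[OF assms(2), of "inv w i"] affine_perms_inv[OF assms(2)] by metis
  show ?thesis
  proof (rule affine_permsI[OF assms(1) inj sh])
    show "(\<Sum>i=1..int n. inv w i - i) = 0"
      using sum_displacement[OF assms inj sh] assms(2) by (simp add: sum_subtractf)
  qed
qed

lemma id_affine_perms: "id \<in> affine_perms n"
  by (simp add: affine_perms_def sum_upto_int)

text \<open>A value skipped between \<open>f x\<close> and \<open>f (x + 1)\<close> would be
  attained strictly between \<open>x\<close> and \<open>x + 1\<close>.\<close>

lemma strict_mono_int_translation:
  fixes f :: "int \<Rightarrow> int"
  assumes "strict_mono f" "surj f"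
  shows "\<exists>c. \<forall>x. f x = x + c"
proof -
  have 1: "f (x + 1) = f x + 1" for x
  proof (rule ccontr)
    assume "f (x + 1) \<noteq> f x + 1"
    moreover have "f x < f (x + 1)" using assms(1) by (simp add: strict_mono_def)
    moreover obtain z where "f z = f x + 1" using assms(2) by (metis surjD)
    ultimately have "f x < f z" "f z < f (x + 1)" by auto
    then have "x < z" "z < x + 1" using strict_mono_less[OF assms(1)] by blast+
    then show False by simp
  qed
  have "f x = x + f 0" for x using shift_mult[of f 1 0 x] 1 by simp
  then show ?thesis by blast
qed

lemma affine_perms_translation:
  assumes "n > 0" "u \<in> affine_perms n" "u' \<in> affine_perms n" "\<And>x. u' x = u x + c"
  shows "c = 0"
  using affine_perms_sum[OF assms(2)] affine_perms_sum[OF assms(3)] assms(1,4)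
  by (simp add: sum.distrib sum_subtractf)

text \<open>The hypothesis makes \<open>u' \<circ> inv u\<close> an increasing bijection, hence a
  translation, and the normalised sum excludes a nonzero one. Thus \<open>pi_down\<close> can be
  identified from an order on positions alone.\<close>

lemma affine_perms_eqI:
  assumes "n > 0" "u \<in> affine_perms n" "u' \<in> affine_perms n" "\<And>x y. u x < u y \<Longrightarrow> u' x < u' y"
  shows "u = u'"
proof -
  have "strict_mono (u' \<circ> inv u)"
    by (rule strict_monoI) (use assms in simp)
  moreover have "surj (u' \<circ> inv u)"
    using affine_perms_comp[OF assms(1,3) affine_perms_inverse[OF assms(1,2)]] affine_perms_bij bij_is_surj by blast
  ultimately obtain c where c: "\<And>x. (u' \<circ> inv u) x = x + c" using strict_mono_int_translation by blast
  have "u' x = u x + c" for x using c[of "u x"] assms(2) by simp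
  moreover from this have "c = 0" using affine_perms_translation assms by blast
  ultimately show ?thesis by auto
qed

section \<open>Length and inversions\<close>

lemma affine_simple_invol:
  assumes "n \<ge> 2"
  shows "affine_simple n a (affine_simple n a j) = j"
proof -
  have ndvd: "\<not> int n dvd 1" using assms by simp
  have A: "\<not> (int n dvd j - a \<and> int n dvd j - (a + 1))" for j
  proof
    assume "int n dvd j - a \<and> int n dvd j - (a + 1)"
    then have "int n dvd (j - a) - (j - (a + 1))" using dvd_diff by blast
    then show False using ndvd by simp
  qed
  show ?thesis using A[of j] A[of "j - 1"] A[of "j + 1"]
    by (auto simp: affine_simple_def algebra_simps)
qed

text \<open>Every value moves by at most one, so only two adjacent values that are exchanged with
  each other can change their relative order.\<close>

lemma affine_simple_less:
  assumes "n \<ge> 2" "x \<noteq> y" "\<not> (int n dvd x - a \<and> y = x + 1)" "\<not> (int n dvd y - a \<and> x = y + 1)"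
  shows "affine_simple n a x < affine_simple n a y \<longleftrightarrow> x < y"
proof -
  have *: "affine_simple n a x < affine_simple n a y"
    if "x < y" "\<not> (int n dvd x - a \<and> y = x + 1)" for x y
  proof -
    have le: "affine_simple n a x \<le> x + 1" "affine_simple n a y \<ge> y - 1"
      by (simp_all add: affine_simple_def)
    have ne: "affine_simple n a x \<noteq> affine_simple n a y"
      using affine_simple_invol[OF assms(1)] that(1) by (metis less_irrefl)
    show ?thesis
    proof (cases "y = x + 1")
      case True
      then have "affine_simple n a x \<le> x" "affine_simple n a y \<ge> y"
        using that by (auto simp: affine_simple_def algebra_simps)
      then show ?thesis using True by simp
    qed (use le ne that in linarith)
  qed
  show ?thesis using *[of x y] *[of y x] assms by (cases x y rule: linorder_cases) auto
qed

lemma affine_simple_affine_perms: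
  assumes "n \<ge> 2"
  shows "affine_simple n a \<in> affine_perms n"
proof -
  have n: "n > 0" using assms by simp
  have inj: "inj (affine_simple n a)"
    using affine_simple_invol[OF assms] by (metis injI)
  have sh: "affine_simple n a (i + int n) = affine_simple n a i + int n" for i
  proof -
    have "int n dvd i + int n - b \<longleftrightarrow> int n dvd i - b" for b
      using dvd_add_left_iff[of "int n" "int n" "i - b"] by (simp add: algebra_simps)
    then show ?thesis by (simp add: affine_simple_def)
  qed
  let ?d = "\<lambda>x. affine_simple n a x - x"
  \<comment> \<open>The period is made to start at \<open>a\<close>; then only its first two
    positions move, by \<open>1\<close> and by \<open>-1\<close>.\<close>
  have "(\<Sum>i=1..int n. ?d i) = (\<Sum>i=1..int n. ?d (i + (a - 1)))"
    by (rule sum_periodic[symmetric]) (use n sh in \<open>auto simp: inj_def\<close>)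
  also have "\<dots> = (\<Sum>i\<in>{1,2}. ?d (i + (a - 1)))"
  proof (rule sum.mono_neutral_right)
    show "\<forall>i\<in>{1..int n} - {1, 2}. ?d (i + (a - 1)) = 0"
    proof
      fix i assume i: "i \<in> {1..int n} - {1, 2}"
      then have "\<not> int n dvd i - 1" "\<not> int n dvd i - 2"
        using zdvd_not_zless[of "i - 1" "int n"] zdvd_not_zless[of "i - 2" "int n"] by auto
      then show "?d (i + (a - 1)) = 0" by (simp add: affine_simple_def)
    qed
  qed (use assms in auto)
  also have "\<dots> = 0" using assms by (simp add: affine_simple_def)
  finally have "(\<Sum>i=1..int n. ?d i) = 0" .
  then show ?thesis by (rule affine_permsI[OF n inj sh])
qed

text \<open>A translate of an inversion by a multiple of \<open>n\<close> is again one. Requiring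
  the left position to lie in \<open>{1..n}\<close> selects one inversion from each such family,
  which keeps the set finite.\<close>

definition inversions :: "nat \<Rightarrow> (int \<Rightarrow> int) \<Rightarrow> (int \<times> int) set" where
  "inversions n w = {(i, j). i \<in> {1..int n} \<and> i < j \<and> w j < w i}"

lemma affine_perms_displacement_bound:
  assumes "n > 0" "w \<in> affine_perms n"
  shows "\<exists>c. \<forall>i. c \<le> w i - i"
proof (intro exI allI)
  fix i
  have "w i - i = w (i mod int n) - i mod int n"
    using affine_perms_shift[OF assms(2), of "i mod int n" "i div int n"]
    by (simp add: algebra_simps minus_mod_eq_mult_div)
  moreover have "i mod int n \<in> {0..<int n}" using assms(1) by simp
  ultimately show "Min ((\<lambda>i. w i - i) ` {0..<int n}) \<le> w i - i" by simp
qed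

lemma finite_inversions:
  assumes "n > 0" "w \<in> affine_perms n"
  shows "finite (inversions n w)"
proof -
  obtain c where c: "\<And>i. c \<le> w i - i" using affine_perms_displacement_bound[OF assms] by blast
  have "inversions n w \<subseteq> (SIGMA i:{1..int n}. {i..w i - c})"
  proof (clarsimp simp: inversions_def)
    fix i j assume "w j < w i" then show "j \<le> w i - c" using c[of j] by simp
  qed
  then show ?thesis by (rule finite_subset) simp
qed

text \<open>A new inversion must consist of the positions of two exchanged values. All such pairs
  are translates of one another, and only one has its left position in
  \<open>{1..n}\<close>.\<close>

lemma card_inversions_simple:
  assumes "n \<ge> 2" "w \<in> affine_perms n"
  shows "card (inversions n (affine_simple n a \<circ> w)) \<le> card (inversions n w) + 1"
proof -
  let ?s = "affine_simple n a"
  let ?D = "inversions n (?s \<circ> w) - inversions n w"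
  have n: "n > 0" using assms by simp
  have fin: "finite (inversions n (?s \<circ> w))"
    using finite_inversions affine_perms_comp affine_simple_affine_perms assms n by blast
  have D: "int n dvd w i - a \<and> w j = w i + 1 \<and> i \<in> {1..int n}" if "(i, j) \<in> ?D" for i j
  proof -
    have ij: "i \<in> {1..int n}" "i < j" "?s (w j) < ?s (w i)" "w i \<le> w j"
      using that by (auto simp: inversions_def)
    moreover from this have "w i \<noteq> w j" using affine_perms_inj[OF assms(2)] by simp
    ultimately show ?thesis
      using affine_simple_less[OF assms(1), of "w j" "w i" a] by linarith
  qed
  have "card ?D \<le> Suc 0"
  proof (subst card_le_Suc0_iff_eq)
    show "\<forall>a1\<in>?D. \<forall>a2\<in>?D. a1 = a2"
    proof (intro ballI)
      fix a1 a2 assume "a1 \<in> ?D" "a2 \<in> ?D"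
      moreover obtain i j i' j' where a12: "a1 = (i, j)" "a2 = (i', j')" by (cases a1, cases a2) auto
      ultimately have *: "int n dvd w i - a" "w j = w i + 1" "i \<in> {1..int n}"
        "int n dvd w i' - a" "w j' = w i' + 1" "i' \<in> {1..int n}" using D by blast+
      then have "int n dvd (w i - a) - (w i' - a)" using dvd_diff by blast
      then have "int n dvd i - i'" using affine_perms_dvd[OF assms(2)] by simp
      then have "i = i'" using *(3,6) zdvd_not_zless[of "i - i'" "int n"] zdvd_not_zless[of "i' - i" "int n"]
        by (cases i i' rule: linorder_cases) (auto simp: dvd_diff_commute)
      moreover from this have "j = j'" using * affine_perms_inj[OF assms(2), of j j'] by simp
      ultimately show "a1 = a2" using a12 by simp
    qed
  qed (use fin in simp)
  then have "card (inversions n w \<union> ?D) \<le> card (inversions n w) + 1"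
    using card_Un_le[of "inversions n w" ?D] by linarith
  moreover have "card (inversions n (?s \<circ> w)) \<le> card (inversions n w \<union> ?D)"
    by (rule card_mono) (use fin finite_inversions[OF n assms(2)] in auto)
  ultimately show ?thesis by linarith
qed

section \<open>Words in the generators, inversions and the weak order\<close>

lemma affine_word_affine_perms: "n \<ge> 2 \<Longrightarrow> affine_word n is \<in> affine_perms n"
  by (induction "is")
    (auto simp: affine_word_def id_affine_perms affine_perms_comp affine_simple_affine_perms)

lemma affine_word_Cons: "affine_word n (a # is) = affine_simple n a \<circ> affine_word n is"
  by (simp add: affine_word_def)

lemma card_inversions_word:
  assumes "n \<ge> 2" "u \<in> affine_perms n"
  shows "card (inversions n (affine_word n is \<circ> u)) \<le> card (inversions n u) + length is"
proof (induction "is")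
  case (Cons a "is")
  have "affine_word n is \<circ> u \<in> affine_perms n"
    using affine_perms_comp affine_word_affine_perms assms by simp
  from card_inversions_simple[OF assms(1) this, of a] Cons show ?case
    by (simp add: affine_word_Cons comp_def)
qed (simp add: affine_word_def)

lemma affine_simple_cong:
  assumes "int n dvd a - b"
  shows "affine_simple n a = affine_simple n b"
proof
  fix j
  have "int n dvd j - a \<longleftrightarrow> int n dvd j - b" for j
    using dvd_add_right_iff[OF assms, of "j - a"] by (simp add: algebra_simps)
  from this[of j] this[of "j - 1"] show "affine_simple n a j = affine_simple n b j"
    by (simp add: affine_simple_def algebra_simps)
qed

text \<open>This is bubble sort from \<open>u'\<close> down to \<open>u\<close>: as long as they
  differ, some two consecutive values of \<open>u'\<close> form an inversion that \<open>u\<close>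
  does not have. Exchanging them removes exactly one inversion and keeps all those of
  \<open>u\<close>.\<close>

lemma inversions_subset_word:
  assumes "n \<ge> 2" "u \<in> affine_perms n" "u' \<in> affine_perms n"
    "\<And>x y. x < y \<Longrightarrow> u y < u x \<Longrightarrow> u' y < u' x"
  shows "\<exists>is. set is \<subseteq> {1..int n} \<and> length is + card (inversions n u) = card (inversions n u') \<and>
    u' = affine_word n is \<circ> u"
  using assms(3,4)
proof (induction "card (inversions n u')" arbitrary: u' rule: less_induct)
  case less
  have n: "n > 0" using assms(1) by simp
  show ?case
  proof (cases "u' = u")
    case True
    then show ?thesis by (intro exI[of _ "[]"]) (simp add: affine_word_def)
  next
    case False
    \<comment> \<open>Otherwise \<open>u \<circ> inv u'\<close> increases at every step, so both
      permutations order the positions alike and are equal.\<close>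
    have "\<exists>a. u (inv u' (a + 1)) < u (inv u' a)"
    proof (rule ccontr)
      assume *: "\<nexists>a. u (inv u' (a + 1)) < u (inv u' a)"
      have step: "u (inv u' a) < u (inv u' (a + 1))" for a
      proof -
        have "u (inv u' a) \<noteq> u (inv u' (a + 1))"
          using affine_perms_inj[OF assms(2)] affine_perms_inj[OF affine_perms_inverse[OF n less.prems(1)]] by simp
        then show ?thesis using * by (meson linorder_neqE)
      qed
      have mono: "u (inv u' a) < u (inv u' b)" if "a < b" for a b
        using that by (induction b rule: int_gr_induct) (use step order.strict_trans in blast)+
      have "u' = u"
      proof (rule affine_perms_eqI[OF n less.prems(1) assms(2)])
        fix x y assume "u' x < u' y"
        from mono[OF this] show "u x < u y" using less.prems(1) by simp
      qed
      then show False using False by simp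
    qed
    then obtain a0 where a0: "u (inv u' (a0 + 1)) < u (inv u' a0)" by blast
    obtain l where a: "a0 + l * int n \<in> {1..int n}" using shift_into_period[OF n] by blast
    define a where "a = a0 + l * int n"
    have aa0: "int n dvd a - a0" by (simp add: a_def)
    let ?s = "affine_simple n a"
    have s: "?s = affine_simple n a0" using affine_simple_cong[OF aa0] .
    define x y where "x = inv u' (a0 + 1)" "y = inv u' a0"
    have xy: "u' x = a0 + 1" "u' y = a0" using less.prems(1) by (simp_all add: x_y_def)
    \<comment> \<open>In the opposite order the pair would be an inversion of \<open>u\<close>,
      hence of \<open>u'\<close>, against its values \<open>a0 + 1\<close> and
      \<open>a0\<close>.\<close>
    have "x < y"
    proof (rule ccontr)
      assume "\<not> x < y"
      then have "y < x" using xy by (cases x y rule: linorder_cases) auto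
      then have "u' x < u' y" using less.prems(2) a0 by (simp add: x_y_def)
      then show False using xy by simp
    qed
    define v where "v = ?s \<circ> u'"
    have v: "v \<in> affine_perms n"
      using affine_perms_comp n affine_simple_affine_perms assms(1) less.prems(1) by (simp add: v_def)
    have u'v: "u' = ?s \<circ> v" using affine_simple_invol[OF assms(1)] by (auto simp: v_def)
    have exc: "\<exists>m. i = y + m * int n \<and> j = x + m * int n"
      if d: "int n dvd u' i - a0" "u' j = u' i + 1" for i j
    proof -
      obtain m where "u' i = a0 + m * int n"
        using dvd_diff_shift[OF d(1)] by blast
      then have "u' i = u' (y + m * int n)" "u' j = u' (x + m * int n)"
        using d affine_perms_shift[OF less.prems(1)] xy by auto
      then show ?thesis using affine_perms_inj[OF less.prems(1)] by blast
    qed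
    have sub: "u' j < u' i" if "i < j" "v j < v i" for i j
    proof (rule ccontr)
      assume "\<not> u' j < u' i"
      moreover have "u' i \<noteq> u' j" using that affine_perms_inj[OF less.prems(1)] by simp
      ultimately have "int n dvd u' i - a0 \<and> u' j = u' i + 1"
        using affine_simple_less[OF assms(1), of "u' j" "u' i" a0] that s by (auto simp: v_def)
      then show False using exc[of i j] \<open>x < y\<close> that by auto
    qed
    obtain m where xm: "x + m * int n \<in> {1..int n}" using shift_into_period[OF n] by blast
    have vxy: "\<not> v (y + m * int n) < v (x + m * int n)"
    proof -
      have "?s (a0 + 1) = a0" "?s a0 = a0 + 1" using assms(1) s by (auto simp: affine_simple_def)
      then show ?thesis using affine_perms_shift[OF v] xy by (simp add: v_def)
    qed
    have psub: "inversions n v \<subset> inversions n u'"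
    proof
      show "inversions n v \<subseteq> inversions n u'" using sub by (auto simp: inversions_def)
      have "(x + m * int n, y + m * int n) \<in> inversions n u'"
        using xm \<open>x < y\<close> xy affine_perms_shift[OF less.prems(1)] by (simp add: inversions_def)
      moreover have "(x + m * int n, y + m * int n) \<notin> inversions n v"
        using vxy by (simp add: inversions_def)
      ultimately show "inversions n v \<noteq> inversions n u'" by blast
    qed
    then have lt: "card (inversions n v) < card (inversions n u')"
      using psubset_card_mono finite_inversions[OF n less.prems(1)] by blast
    moreover have "card (inversions n u') \<le> card (inversions n v) + 1"
      using card_inversions_simple[OF assms(1) v, of a] u'v by simp
    ultimately have c: "card (inversions n u') = card (inversions n v) + 1" by simp
    have "v j < v i" if "i < j" "u j < u i" for i j
    proof (rule ccontr)
      assume *: "\<not> v j < v i"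
      have "u' j < u' i" using less.prems(2) that by blast
      then have "int n dvd u' j - a0 \<and> u' i = u' j + 1"
        using affine_simple_less[OF assms(1), of "u' j" "u' i" a0] * s by (auto simp: v_def)
      then obtain k where "j = y + k * int n" "i = x + k * int n" using exc[of j i] by blast
      then have "u x > u y" using that affine_perms_shift[OF assms(2)] by simp
      then show False using a0 by (simp add: x_y_def)
    qed
    from less.hyps[OF lt v this] obtain "is" where "is": "set is \<subseteq> {1..int n}"
      "length is + card (inversions n u) = card (inversions n v)" "v = affine_word n is \<circ> u" by auto
    show ?thesis
    proof (intro exI[of _ "a # is"] conjI)
      show "u' = affine_word n (a # is) \<circ> u" using u'v "is"(3) by (simp add: affine_word_Cons comp_assoc)
    qed (use a "is" c in \<open>auto simp: a_def\<close>)
  qed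
qed

text \<open>The bubble sort word bounds the length from above. It is shortest because each letter
  creates at most one inversion.\<close>

lemma affine_length_inversions_diff:
  assumes "n \<ge> 2" "u \<in> affine_perms n" "u' \<in> affine_perms n"
    "\<And>x y. x < y \<Longrightarrow> u y < u x \<Longrightarrow> u' y < u' x"
  shows "affine_length n (u' \<circ> inv u) + card (inversions n u) = card (inversions n u')"
proof -
  obtain "is" where "is": "set is \<subseteq> {1..int n}"
    "length is + card (inversions n u) = card (inversions n u')" "u' = affine_word n is \<circ> u"
    using inversions_subset_word[OF assms] by blast
  have eq: "w \<circ> u = u' \<longleftrightarrow> w = u' \<circ> inv u" for w
    using assms(2) by (auto simp: fun_eq_iff) (metis affine_perms_inv)
  have "affine_length n (u' \<circ> inv u) = length is"
    unfolding affine_length_def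
  proof (rule Least_equality)
    show "\<exists>isa. set isa \<subseteq> {1..int n} \<and> length isa = length is \<and> affine_word n isa = u' \<circ> inv u"
      using "is" eq by metis
    fix k assume "\<exists>is. set is \<subseteq> {1..int n} \<and> length is = k \<and> affine_word n is = u' \<circ> inv u"
    then obtain js where "length js = k" "affine_word n js \<circ> u = u'" using eq by blast
    then show "length is \<le> k" using card_inversions_word[OF assms(1,2), of js] "is"(2) by simp
  qed
  then show ?thesis using "is"(2) by simp
qed

lemma affine_length_eq_card_inversions:
  assumes "n \<ge> 2" "w \<in> affine_perms n"
  shows "affine_length n w = card (inversions n w)"
proof -
  have "inversions n id = {}" by (auto simp: inversions_def)
  then show ?thesis
    using affine_length_inversions_diff[OF assms(1) id_affine_perms assms(2)] by simp
qed

lemma left_weak_le_iff_card: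
  assumes "n \<ge> 2" "x \<in> affine_perms n" "y \<in> affine_perms n"
  shows "left_weak_le n x y \<longleftrightarrow>
    affine_length n (y \<circ> inv x) + card (inversions n x) = card (inversions n y)"
  using affine_length_eq_card_inversions assms by (auto simp: left_weak_le_def)

section \<open>Sylvester classes and postorder\<close>

lemma tree_le_iff: "tree_le w i j \<longleftrightarrow> (\<forall>k. min i j \<le> k \<and> k \<le> max i j \<longrightarrow> w k \<le> w j)"
proof
  assume *: "tree_le w i j"
  show "\<forall>k. min i j \<le> k \<and> k \<le> max i j \<longrightarrow> w k \<le> w j"
  proof (intro allI impI)
    fix k assume k: "min i j \<le> k \<and> k \<le> max i j"
    show "w k \<le> w j"
    proof (cases "k = i \<or> k = j")
      case True
      then show ?thesis using * by (auto simp: tree_le_def)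
    next
      case False
      then have "min i j < k" "k < max i j" using k by (auto simp: min_def max_def split: if_splits)
      moreover have "max (w i) (w j) = w j" using * by (simp add: tree_le_def max_def)
      ultimately show ?thesis using * unfolding tree_le_def tree_incomparable_def
        by (metis linorder_not_less)
    qed
  qed
next
  assume *: "\<forall>k. min i j \<le> k \<and> k \<le> max i j \<longrightarrow> w k \<le> w j"
  then have "w i \<le> w j" by simp
  moreover from this have "\<not> tree_incomparable w i j"
  proof (clarsimp simp: tree_incomparable_def)
    fix k assume "min i j < k" "k < max i j" "w j < w k"
    then show False using *[rule_format, of k] by simp
  qed
  ultimately show "tree_le w i j" by (simp add: tree_le_def)
qed

text \<open>An interval that ends at one of the two exchanged positions and contains the other also
  contains a translate of \<open>k\<close>. Its value is larger than both, so neither position is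
  the maximum of the interval, before or after the exchange.\<close>

lemma tree_le_simple:
  assumes n: "n \<ge> 2" and u: "u \<in> affine_perms n" and xy: "x < y" "u x = u y + 1"
    and k: "x < k" "k < y" "u x < u k"
  shows "tree_le (affine_simple n (u y) \<circ> u) = tree_le u"
proof -
  let ?s = "affine_simple n (u y)"
  have "(\<exists>h. min i j \<le> h \<and> h \<le> max i j \<and> ?s (u j) < ?s (u h)) \<longleftrightarrow>
      (\<exists>h. min i j \<le> h \<and> h \<le> max i j \<and> u j < u h)" for i j
  proof (cases "\<exists>m. (j = x + m * int n \<and> min i j \<le> y + m * int n \<and> y + m * int n \<le> max i j) \<or>
      (j = y + m * int n \<and> min i j \<le> x + m * int n \<and> x + m * int n \<le> max i j)")
    case True
    then obtain m where m: "j = x + m * int n \<and> min i j \<le> y + m * int n \<and> y + m * int n \<le> max i j \<or>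
      j = y + m * int n \<and> min i j \<le> x + m * int n \<and> x + m * int n \<le> max i j" by blast
    define h where "h = k + m * int n"
    have h: "min i j \<le> h" "h \<le> max i j" using m k(1,2) by (auto simp: h_def)
    have uh: "u h = u k + m * int n" using affine_perms_shift[OF u] by (simp add: h_def)
    have uj: "u j = u x + m * int n \<or> u j = u y + m * int n"
      using m affine_perms_shift[OF u] by auto
    have lt: "u j < u h" using uj uh xy k by auto
    \<comment> \<open>The exchange must not act on the pair \<open>j\<close>, \<open>h\<close>. If
      it did, \<open>u j\<close> would have to be the upper of the two exchanged values and also
      congruent to the lower one, so that \<open>n\<close> divides \<open>1\<close>.\<close>
    have "\<not> (int n dvd u j - u y \<and> u h = u j + 1)"
    proof
      assume *: "int n dvd u j - u y \<and> u h = u j + 1"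
      then have "u j \<noteq> u y + m * int n" using uh k(3) xy by auto
      then have "u j - u y = 1 + m * int n" using uj xy by simp
      then have "int n dvd 1" using * by (metis dvd_add_triv_right_iff mult.commute dvd_add_times_triv_right_iff)
      then show False using n by simp
    qed
    moreover have "u j \<noteq> u h + 1" using lt by simp
    ultimately have "?s (u j) < ?s (u h)" using affine_simple_less[OF n, of "u j" "u h" "u y"] lt by auto
    then show ?thesis using h lt by blast
  next
    case False
    have exc: "\<exists>m. i = y + m * int n \<and> j = x + m * int n"
      if d: "int n dvd u i - u y" "u j = u i + 1" for i j
    proof -
      obtain m where "u i = u y + m * int n"
        using dvd_diff_shift[OF d(1)] by blast
      then have "u i = u (y + m * int n)" "u j = u (x + m * int n)"
        using d affine_perms_shift[OF u] xy by auto
      then show ?thesis using affine_perms_inj[OF u] by blast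
    qed
    have "?s (u j) < ?s (u h) \<longleftrightarrow> u j < u h" if h: "min i j \<le> h" "h \<le> max i j" for h
    proof (cases "u j = u h")
      case ne: False
      have "\<not> (int n dvd u j - u y \<and> u h = u j + 1)" using exc[of j h] False h by blast
      moreover have "\<not> (int n dvd u h - u y \<and> u j = u h + 1)" using exc[of h j] False h by blast
      ultimately show ?thesis using affine_simple_less[OF n ne] by blast
    qed simp
    then show ?thesis by blast
  qed
  then show ?thesis by (intro ext) (simp add: tree_le_iff, meson linorder_not_less)
qed

text \<open>The order of the positions in the postorder reading of the tree: a position comes after
  its descendants, and incomparable positions come from left to right.\<close>

definition pops_before :: "(int \<Rightarrow> int) \<Rightarrow> int \<Rightarrow> int \<Rightarrow> bool" where
  "pops_before v x y \<longleftrightarrow> (x < y \<and> (\<exists>k. x < k \<and> k \<le> y \<and> v x < v k)) \<or>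
     (y < x \<and> (\<forall>k. y < k \<and> k \<le> x \<longrightarrow> v k < v y))"

lemma pops_before_total:
  assumes "v \<in> affine_perms n" "x \<noteq> y"
  shows "pops_before v y x \<longleftrightarrow> \<not> pops_before v x y"
proof -
  have *: "pops_before v y x \<longleftrightarrow> \<not> pops_before v x y" if "x < y" for x y
  proof -
    have "v k < v x \<longleftrightarrow> \<not> v x < v k" if "x < k" for k
      using affine_perms_inj[OF assms(1), of x k] that by auto
    then have "(\<forall>k. x < k \<and> k \<le> y \<longrightarrow> v k < v x) \<longleftrightarrow> \<not> (\<exists>k. x < k \<and> k \<le> y \<and> v x < v k)" by blast
    then show ?thesis using that by (simp add: pops_before_def)
  qed
  show ?thesis using *[of x y] *[of y x] assms(2) by (cases x y rule: linorder_cases) auto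
qed

text \<open>When \<open>y < x\<close>, being popped before \<open>y\<close> means that
  \<open>x\<close> is a descendant of \<open>y\<close>, which all members of the class agree on.
  These are the inversions forced on the whole class.\<close>

lemma tree_le_inversion:
  assumes v: "v \<in> affine_perms n" and "u \<in> affine_perms n" "tree_le u = tree_le v"
    and "y < x" "pops_before v x y"
  shows "u x < u y"
proof -
  have "tree_le v x y" using assms(4,5)
    by (force simp: tree_le_iff pops_before_def le_less)
  then have "tree_le u x y" using assms(3) by simp
  then have "u x \<le> u y" by (simp add: tree_le_def)
  then show ?thesis using affine_perms_inj[OF assms(2), of x y] assms(4) by simp
qed

text \<open>An unforced inversion with the least difference of values has difference one. Exchanging
  its two values stays inside the class and removes an inversion, so a member with fewest inversions
  has only forced ones.\<close>

lemma minimal_inversions_pops_before: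
  assumes n: "n \<ge> 2" and v: "v \<in> affine_perms n" and u: "u \<in> sylvester_class n v"
    and min: "\<And>u'. u' \<in> sylvester_class n v \<Longrightarrow> card (inversions n u) \<le> card (inversions n u')"
  shows "u x < u y \<longleftrightarrow> pops_before v x y"
proof -
  have u': "u \<in> affine_perms n" "tree_le u = tree_le v"
    using u by (auto simp: sylvester_class_def sylvester_congruent_def)
  have n0: "n > 0" using n by simp
  have noninv: "u x < u y" if "x < y" "pops_before v x y" for x y
  proof (rule ccontr)
    define bad where "bad = (\<lambda>x y. x < y \<and> pops_before v x y \<and> u y < u x)"
    assume "\<not> u x < u y"
    then have "bad x y" using that affine_perms_inj[OF u'(1), of x y] by (auto simp: bad_def)
    then have "\<exists>d x y. bad x y \<and> nat (u x - u y) = d" by blast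
    then obtain d where d: "\<exists>x y. bad x y \<and> nat (u x - u y) = d"
      "\<And>e. e < d \<Longrightarrow> \<not> (\<exists>x y. bad x y \<and> nat (u x - u y) = e)"
      using exists_least_iff[of "\<lambda>d. \<exists>x y. bad x y \<and> nat (u x - u y) = d"] by auto
    then obtain x y where xy: "bad x y" "nat (u x - u y) = d" by blast
    have least: "\<not> bad a b" if "u a - u b < u x - u y" "u b < u a" for a b
    proof
      assume "bad a b"
      moreover have "nat (u a - u b) < d" using that xy(2) by linarith
      ultimately show False using d(2) by blast
    qed
    from xy(1) obtain k where k: "x < k" "k \<le> y" "v x < v k" "u y < u x" "x < y"
      by (auto simp: bad_def pops_before_def)
    \<comment> \<open>Wherever the position \<open>z\<close> of a value strictly in between lies, it
      forms inversions with \<open>x\<close> or \<open>y\<close> of smaller difference. These are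
      forced, and they contradict the position of \<open>z\<close> or the witness
      \<open>k\<close>.\<close>
    have "u x = u y + 1"
    proof (rule ccontr)
      assume "u x \<noteq> u y + 1"
      moreover obtain z where z: "u z = u y + 1" using affine_perms_inv[OF u'(1)] by metis
      ultimately have z: "u y < u z" "u z < u x" using k by auto
      then have zz: "z \<noteq> x" "z \<noteq> y" by auto
      have inv: "\<forall>k. a < k \<and> k \<le> b \<longrightarrow> v k < v a"
        if "a < b" "u b < u a" "u a - u b < u x - u y" for a b
      proof -
        have "\<not> pops_before v a b" using least[of a b] that by (auto simp: bad_def)
        then have "pops_before v b a" using pops_before_total[OF v, of a b] that by simp
        then show ?thesis using that by (auto simp: pops_before_def)
      qed
      consider "z < x" | "x < z" "z < y" | "y < z" using zz by linarith
      then show False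
      proof cases
        case 1
        then have "\<forall>k. z < k \<and> k \<le> y \<longrightarrow> v k < v z" using inv[of z y] z k by auto
        then have "pops_before v x z" using 1 k by (auto simp: pops_before_def)
        then have "u x < u z" by (rule tree_le_inversion[OF v u' 1])
        then show False using z by simp
      next
        case 2
        then have A: "\<forall>k. x < k \<and> k \<le> z \<longrightarrow> v k < v x" and B: "\<forall>k. z < k \<and> k \<le> y \<longrightarrow> v k < v z"
          using inv[of x z] inv[of z y] z by auto
        have "v z < v x" using A 2 by simp
        then show False
          using A[rule_format, of k] B[rule_format, of k] k by (cases "k \<le> z") linarith+
      next
        case 3
        then have "\<forall>k. x < k \<and> k \<le> z \<longrightarrow> v k < v x" using inv[of x z] z k by auto
        then show False using k 3 by force
      qed
    qed
    \<comment> \<open>The witness \<open>k\<close> is large for \<open>v\<close> and need not be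
      large for \<open>u\<close>. What the class transports is that \<open>x\<close> is not the
      maximum of the interval, which yields a witness \<open>h\<close> for \<open>u\<close>.\<close>
    have "\<not> tree_le v y x"
      using k by (auto simp: tree_le_iff not_le intro!: exI[of _ k])
    then have "\<not> tree_le u y x" using u' by simp
    then obtain h where h: "x \<le> h" "h \<le> y" "u x < u h" using k(5) by (auto simp: tree_le_iff not_le)
    then have h': "x < h" "h < y" using k by (auto simp: le_less)
    define w where "w = affine_simple n (u y) \<circ> u"
    have w: "w \<in> affine_perms n"
      using affine_perms_comp[OF n0 affine_simple_affine_perms[OF n] u'(1)] by (simp add: w_def)
    have "w \<in> sylvester_class n v"
      using tree_le_simple[OF n u'(1) k(5) \<open>u x = u y + 1\<close> h' h(3)] u' w
      by (simp add: sylvester_class_def sylvester_congruent_def w_def)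
    then have "card (inversions n u) \<le> card (inversions n w)" by (rule min)
    moreover have "card (inversions n w) < card (inversions n u)"
    proof (rule psubset_card_mono[OF finite_inversions[OF n0 u'(1)]])
      obtain m where xm: "x + m * int n \<in> {1..int n}" using shift_into_period[OF n0] by blast
      have s: "affine_simple n (u y) (u y + 1) = u y" "affine_simple n (u y) (u y) = u y + 1"
        using n by (auto simp: affine_simple_def)
      have "(x + m * int n, y + m * int n) \<in> inversions n u"
        using xm k affine_perms_shift[OF u'(1)] by (simp add: inversions_def)
      moreover have "(x + m * int n, y + m * int n) \<notin> inversions n w"
        using affine_perms_shift[OF w] s \<open>u x = u y + 1\<close> by (simp add: inversions_def w_def)
      moreover have "inversions n w \<subseteq> inversions n u"
      proof (clarsimp simp: inversions_def)
        fix i j assume ij: "i < j" "w j < w i"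
        show "u j < u i"
        proof (rule ccontr)
          assume "\<not> u j < u i"
          moreover have "u i \<noteq> u j" using ij affine_perms_inj[OF u'(1)] by simp
          ultimately have *: "int n dvd u i - u y \<and> u j = u i + 1"
            using affine_simple_less[OF n, of "u j" "u i" "u y"] ij by (auto simp: w_def)
          then obtain m where "u i = u y + m * int n" using dvd_diff_shift by blast
          then have "u i = u (y + m * int n)" "u j = u (x + m * int n)"
            using * affine_perms_shift[OF u'(1)] \<open>u x = u y + 1\<close> by auto
          then have "i = y + m * int n" "j = x + m * int n" using affine_perms_inj[OF u'(1)] by auto
          then show False using ij k by simp
        qed
      qed
      ultimately show "inversions n w \<subset> inversions n u" by blast
    qed
    ultimately show False by simp
  qed
  have "u x < u y" if "pops_before v x y" for x y
    using that noninv tree_le_inversion[OF v u'] by (cases x y rule: linorder_cases) (auto simp: pops_before_def)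
  then show ?thesis
    using pops_before_total[OF v, of x y] by (cases "x = y") (auto simp: pops_before_def dest: order.asym)
qed

text \<open>All inversions of \<open>u\<close> are forced, so \<open>u\<close> lies below every
  member in the weak order. A member below \<open>u\<close> has no more inversions, and the word
  leading to it from \<open>u\<close> is empty.\<close>

lemma pi_down_eq_if_minimal_inversions:
  assumes n: "n \<ge> 2" and v: "v \<in> affine_perms n" and u: "u \<in> sylvester_class n v"
    and min: "\<And>u'. u' \<in> sylvester_class n v \<Longrightarrow> card (inversions n u) \<le> card (inversions n u')"
  shows "pi_down n v = u"
proof -
  have u': "u \<in> affine_perms n" "tree_le u = tree_le v"
    using u by (auto simp: sylvester_class_def sylvester_congruent_def)
  have n0: "n > 0" using n by simp
  have sub: "w y < w x" if "w \<in> sylvester_class n v" "x < y" "u y < u x" for w x y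
    using tree_le_inversion[OF v, of w x y] that minimal_inversions_pops_before[OF n v u min]
    by (auto simp: sylvester_class_def sylvester_congruent_def)
  have aff: "w \<in> affine_perms n" if "w \<in> sylvester_class n v" for w
    using that by (simp add: sylvester_class_def)
  have le: "left_weak_le n u w" if "w \<in> sylvester_class n v" for w
    using left_weak_le_iff_card[OF n u'(1) aff[OF that]]
      affine_length_inversions_diff[OF n u'(1) aff[OF that] sub[OF that]] by blast
  have "w = u" if w: "w \<in> sylvester_class n v" "left_weak_le n w u" for w
  proof -
    have c: "card (inversions n w) \<le> card (inversions n u)"
      using left_weak_le_iff_card[OF n aff[OF w(1)] u'(1)] w(2) by linarith
    obtain "is" where "is": "length is + card (inversions n u) = card (inversions n w)"
      "w = affine_word n is \<circ> u"
      using inversions_subset_word[OF n u'(1) aff[OF w(1)] sub[OF w(1)]] by blast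
    have "length is = 0" using c "is"(1) by linarith
    then show "w = u" using "is"(2) by (simp add: affine_word_def)
  qed
  then show ?thesis unfolding pi_down_def
    by (intro the_equality) (use u le in blast)+
qed

text \<open>A member with fewest inversions exists because inversion counts are natural numbers.
  From here on \<open>pi_down\<close> is used through this order alone.\<close>

lemma pi_down_pops_before:
  assumes n: "n \<ge> 2" and v: "v \<in> affine_perms n"
  shows "pi_down n v \<in> affine_perms n" "pi_down n v x < pi_down n v y \<longleftrightarrow> pops_before v x y"
proof -
  have "v \<in> sylvester_class n v" using v by (simp add: sylvester_class_def sylvester_congruent_def)
  then obtain u where u: "u \<in> sylvester_class n v"
    "\<And>u'. u' \<in> sylvester_class n v \<Longrightarrow> card (inversions n u) \<le> card (inversions n u')"
    using ex_has_least_nat[of "\<lambda>u. u \<in> sylvester_class n v" v "\<lambda>u. card (inversions n u)"] by blast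
  have *: "pi_down n v = u" using pi_down_eq_if_minimal_inversions[OF n v u] by blast
  show "pi_down n v \<in> affine_perms n" using * u by (simp add: sylvester_class_def)
  show "pi_down n v x < pi_down n v y \<longleftrightarrow> pops_before v x y"
    using minimal_inversions_pops_before[OF n v u] * by simp
qed

lemma pi_down_eqI:
  assumes n: "n \<ge> 2" and v: "v \<in> affine_perms n" and u: "u \<in> affine_perms n"
    and "\<And>x y. u x < u y \<Longrightarrow> pops_before v x y"
  shows "pi_down n v = u"
proof (rule affine_perms_eqI[symmetric])
  show "n > 0" using n by simp
  show "pi_down n v x < pi_down n v y" if "u x < u y" for x y
    using that assms(4) pi_down_pops_before(2)[OF n v] by blast
qed (use u pi_down_pops_before(1)[OF n v] in auto)

section \<open>Moving a left child\<close>

text \<open>In every translate of the window \<open>{p..q}\<close>, the position \<open>q\<close> moves to the front of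
  the window.\<close>

definition window_rotation :: "nat \<Rightarrow> int \<Rightarrow> int \<Rightarrow> int \<Rightarrow> int" where
  "window_rotation n p q x =
     (if (x - p) mod int n < q - p then x + 1
      else if (x - p) mod int n = q - p then x - (q - p) else x)"

lemma window_rotation_less:
  assumes "p < q" "q < p + int n" "x \<noteq> y"
  shows "window_rotation n p q x < window_rotation n p q y \<longleftrightarrow>
    (x < y \<and> \<not> (\<exists>m. y = q + m * int n \<and> p + m * int n \<le> x)) \<or>
    (\<exists>m. x = q + m * int n \<and> p + m * int n \<le> y \<and> y < x)"
proof -
  \<comment> \<open>Quotient and remainder relative to \<open>p\<close> give the period block of a
    position and its offset. The rotation keeps the block and changes only the offset.\<close>
  define a b r s where "a = (x - p) div int n" "b = (y - p) div int n"
    "r = (x - p) mod int n" "s = (y - p) mod int n"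
  have n: "int n > 0" using assms by linarith
  have rs: "0 \<le> r" "r < int n" "0 \<le> s" "s < int n" using n by (simp_all add: a_b_r_s_def)
  have x: "x = p + a * int n + r" "y = p + b * int n + s"
    by (simp_all add: a_b_r_s_def)
  have less: "i * int n + int n \<le> j * int n" if "i < j" for i j
  proof -
    have "(i + 1) * int n \<le> j * int n" by (rule mult_right_mono) (use that in auto)
    then show ?thesis by (simp add: algebra_simps)
  qed
  have uniq: "m = j" if "p + m * int n \<le> z" "z < p + m * int n + int n"
    "p + j * int n \<le> z" "z < p + j * int n + int n" for m j z
    using less[of m j] less[of j m] that by (cases m j rule: linorder_cases) auto
  \<comment> \<open>Here \<open>x\<close> may also lie beyond the block of \<open>y\<close>, hence
    \<open>b \<le> a\<close>; the condition \<open>x < y\<close> of the goal then leaves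
    \<open>a = b\<close>.\<close>
  have 1: "(\<exists>m. y = q + m * int n \<and> p + m * int n \<le> x) \<longleftrightarrow> s = q - p \<and> b \<le> a"
  proof
    assume "\<exists>m. y = q + m * int n \<and> p + m * int n \<le> x"
    then obtain m where m: "y = q + m * int n" "p + m * int n \<le> x" by blast
    then have "m = b" using uniq[of m y b] x(2) rs assms by simp
    then show "s = q - p \<and> b \<le> a" using m x rs less[of a b] by force
  next
    assume *: "s = q - p \<and> b \<le> a"
    then show "\<exists>m. y = q + m * int n \<and> p + m * int n \<le> x"
      using x rs less[of b a] by (intro exI[of _ b]) (cases "a = b", auto)
  qed
  have 2: "(\<exists>m. x = q + m * int n \<and> p + m * int n \<le> y \<and> y < x) \<longleftrightarrow> r = q - p \<and> a = b \<and> s < r"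
  proof
    assume "\<exists>m. x = q + m * int n \<and> p + m * int n \<le> y \<and> y < x"
    then obtain m where m: "x = q + m * int n" "p + m * int n \<le> y" "y < x" by blast
    then have "m = a" using uniq[of m x a] x(1) rs assms by simp
    moreover have "m = b" using uniq[of m y b] x(2) rs assms m by simp
    ultimately show "r = q - p \<and> a = b \<and> s < r" using m x by simp
  next
    assume *: "r = q - p \<and> a = b \<and> s < r"
    then show "\<exists>m. x = q + m * int n \<and> p + m * int n \<le> y \<and> y < x"
      using x rs by (intro exI[of _ a]) auto
  qed
  have k: "window_rotation n p q x = p + a * int n + (if r < q - p then r + 1 else if r = q - p then 0 else r)"
    "window_rotation n p q y = p + b * int n + (if s < q - p then s + 1 else if s = q - p then 0 else s)"
    unfolding window_rotation_def a_b_r_s_def(3,4)[symmetric] using x rs assms by auto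
  show ?thesis unfolding 1 2 k using less[of a b] less[of b a] x assms rs
    by (cases a b rule: linorder_cases) auto
qed

lemma window_rotation_affine_perms:
  assumes "p < q" "q < p + int n"
  shows "window_rotation n p q \<in> affine_perms n"
proof -
  let ?k = "window_rotation n p q"
  have n: "n > 0" using assms by linarith
  have inj: "inj ?k"
  proof (rule injI, rule ccontr)
    fix x y assume "?k x = ?k y" "x \<noteq> y"
    then show False using window_rotation_less[OF assms, of x y] window_rotation_less[OF assms, of y x]
      by (cases x y rule: linorder_cases) auto
  qed
  have sh: "?k (i + int n) = ?k i + int n" for i
  proof -
    have "(i + int n - p) mod int n = (i - p) mod int n"
      using mod_add_self2[of "i - p" "int n"] by (simp add: algebra_simps)
    then show ?thesis by (simp add: window_rotation_def)
  qed
  let ?d = "\<lambda>x. ?k x - x"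
  have "(\<Sum>i=1..int n. ?d i) = (\<Sum>i=1..int n. ?d (i + (p - 1)))"
    by (rule sum_periodic[symmetric]) (use n sh in \<open>auto simp: inj_def\<close>)
  \<comment> \<open>In the period that starts at \<open>p\<close>, there are \<open>q - p\<close>
    positions that advance by one and a single one that retreats by \<open>q - p\<close>.\<close>
  also have "\<dots> = (\<Sum>i\<in>{1..int n}. if i \<le> q - p then 1 else if i = q - p + 1 then p - q else 0)"
  proof (rule sum.cong)
    fix i assume "i \<in> {1..int n}"
    then have "(i - 1) mod int n = i - 1" by simp
    then show "?d (i + (p - 1)) = (if i \<le> q - p then 1 else if i = q - p + 1 then p - q else 0)"
      by (auto simp: window_rotation_def)
  qed simp
  also have "\<dots> = (\<Sum>i\<in>insert (q - p + 1) {1..q - p}. if i \<le> q - p then 1 else if i = q - p + 1 then p - q else 0)"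
    by (rule sum.mono_neutral_right) (use assms in auto)
  also have "\<dots> = 0" using assms by simp
  finally have "(\<Sum>i=1..int n. ?d i) = 0" .
  then show ?thesis by (rule affine_permsI[OF n inj sh])
qed

text \<open>The condition on positions left of \<open>p\<close> says that \<open>p\<close> is the left child of \<open>q\<close>, and the one
  on \<open>q + 1\<close> makes the element moved away from \<open>q\<close> superfluous as a witness that an element
  of the window is popped.\<close>

lemma pops_before_window_rotation:
  assumes n: "n \<ge> 2" and v: "v \<in> affine_perms n" and pq: "p < q" "q < p + int n"
    and inner: "\<And>j. p < j \<Longrightarrow> j < q \<Longrightarrow> v j < v p"
    and vq: "v p < v q" "v p < v (q + 1)"
    and left: "\<And>j. j < p \<Longrightarrow> v p < v j \<Longrightarrow> (\<And>k. j < k \<Longrightarrow> k < p \<Longrightarrow> v k < v j) \<Longrightarrow> v q < v j"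
  shows "pops_before v x y \<longleftrightarrow>
    pops_before (v \<circ> inv (window_rotation n p q)) (window_rotation n p q x) (window_rotation n p q y)"
proof -
  let ?k = "window_rotation n p q"
  let ?w = "v \<circ> inv ?k"
  have n0: "n > 0" using n by simp
  have k: "?k \<in> affine_perms n" by (rule window_rotation_affine_perms[OF pq])
  have w: "?w \<in> affine_perms n" by (rule affine_perms_comp[OF n0 v affine_perms_inverse[OF n0 k]])
  have sh: "v (i + m * int n) = v i + m * int n" for i m by (rule affine_perms_shift[OF v])
  have inner': "v j \<le> v (p + m * int n)" "v (p + m * int n) < v (q + m * int n)"
    "v (p + m * int n) < v (q + m * int n + 1)"
    if "p + m * int n \<le> j" "j < q + m * int n" for j m
  proof -
    have "v (j - m * int n) \<le> v p"
      using inner[of "j - m * int n"] that by (cases "j - m * int n = p") auto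
    then show "v j \<le> v (p + m * int n)" using sh[of "j - m * int n" m] sh[of p m] by simp
    show "v (p + m * int n) < v (q + m * int n)" using sh vq(1) by simp
    show "v (p + m * int n) < v (q + m * int n + 1)"
      using sh[of p m] sh[of "q + 1" m] vq(2) by (simp add: algebra_simps)
  qed
  have left': "v (q + m * int n) < v j"
    if "j < p + m * int n" "v (p + m * int n) < v j"
      "\<And>h. j < h \<Longrightarrow> h < p + m * int n \<Longrightarrow> v h < v j" for j m
  proof -
    have vj: "v (j - m * int n) = v j - m * int n" using sh[of "j - m * int n" m] by simp
    have "v q < v (j - m * int n)"
    proof (rule left)
      fix h assume "j - m * int n < h" "h < p"
      then have "v (h + m * int n) < v j" by (intro that(3)) auto
      then show "v h < v (j - m * int n)" using sh[of h m] vj by simp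
    qed (use that sh[of p m] vj in auto)
    then show ?thesis using sh[of q m] vj by simp
  qed
  \<comment> \<open>These are exactly the pairs whose order the rotation reverses: \<open>y\<close>
    is the moved position of a window and \<open>x\<close> stands before it in that window.\<close>
  define blk where "blk x y \<longleftrightarrow> (\<exists>m. y = q + m * int n \<and> p + m * int n \<le> x \<and> x < y)" for x y
  have kless: "?k x < ?k y \<longleftrightarrow> x < y \<and> \<not> blk x y \<or> blk y x" for x y
    using window_rotation_less[OF pq, of x y] by (cases "x = y") (auto simp: blk_def)
  have wk: "?w (?k x) = v x" for x using k by simp
  have surj: "\<exists>j. h = ?k j" for h using affine_perms_inv(1)[OF k] by metis
  have blk_v: "v x < v y" if "blk x y" for x y
    using that inner'(1)[of _ x] inner'(2)[of _ x] by (fastforce simp: blk_def)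
  have blk_not_q1: "\<not> blk x (q + m * int n + 1)" for x m
  proof
    assume "blk x (q + m * int n + 1)"
    then obtain m' where "q + m * int n + 1 = q + m' * int n" by (auto simp: blk_def)
    then have "1 = (m' - m) * int n" by (simp add: algebra_simps)
    then have "int n dvd 1" by (metis dvd_triv_right)
    then show False using n by simp
  qed
  \<comment> \<open>One implication suffices, since both relations are total on distinct
    positions.\<close>
  have imp: "pops_before ?w (?k x) (?k y)" if pb: "pops_before v x y" for x y
  proof (cases "x < y")
    case True
    then obtain h where h: "x < h" "h \<le> y" "v x < v h" using pb by (auto simp: pops_before_def)
    show ?thesis
    proof (cases "blk x y")
      case blk: True
      \<comment> \<open>Now \<open>y\<close> has been moved in front of \<open>x\<close>, so
        \<open>x\<close> must become its descendant. Everything that \<open>y\<close> has overtaken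
        up to \<open>x\<close> comes from its window, where \<open>y\<close> has the largest
        value.\<close>
      have "?w i < ?w (?k y)" if "?k y < i" "i \<le> ?k x" for i
      proof -
        obtain j where j: "i = ?k j" using surj by blast
        have 1: "y < j \<and> \<not> blk y j \<or> blk j y" using that j kless[of y j] by blast
        have 2: "x = j \<or> j < x \<and> \<not> blk j x \<or> blk x j"
          using that j kless[of j x] affine_perms_inj[OF k, of j x] by linarith
        have "blk j y"
        proof (rule ccontr)
          assume "\<not> blk j y"
          then have yj: "y < j" "\<not> blk y j" using 1 by auto
          then have "blk x j" using 2 True by auto
          then obtain m where "j = q + m * int n" "p + m * int n \<le> x" by (auto simp: blk_def)
          then have "blk y j" using yj True unfolding blk_def by (intro exI[of _ m]) auto
          then show False using yj by blast
        qed
        then show ?thesis unfolding j wk by (rule blk_v)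
      qed
      moreover have "?k y < ?k x" using kless[of y x] blk by blast
      ultimately show ?thesis unfolding pops_before_def by blast
    next
      case nblk: False
      have "\<exists>j. v x < v j \<and> ?k x < ?k j \<and> (j = y \<or> ?k j < ?k y)"
      proof (cases "h = y \<or> blk h y")
        case True
        then have "v x < v y" using h blk_v[of h y] by fastforce
        then show ?thesis using kless[of x y] nblk \<open>x < y\<close> by blast
      next
        case hy: False
        show ?thesis
        proof (cases "blk x h")
          case True
          then obtain m where m: "h = q + m * int n" "p + m * int n \<le> x" "x < h" by (auto simp: blk_def)
          \<comment> \<open>The witness \<open>h\<close> itself has jumped to the left of
            \<open>x\<close>; its right neighbour, which also exceeds the whole window up to that
            point, takes over.\<close>
          then have vq: "v x < v (h + 1)" using inner'[of m x] by fastforce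
          have "?k x < ?k (h + 1)" using kless[of x "h + 1"] h m blk_not_q1[of x m] by auto
          moreover have "h + 1 = y \<or> ?k (h + 1) < ?k y \<or> blk (h + 1) y" using kless[of "h + 1" y] h hy by fastforce
          ultimately show ?thesis using vq blk_v[of "h + 1" y] kless[of x y] nblk \<open>x < y\<close>
            by (metis order.strict_trans)
        next
          case False
          then have "?k x < ?k h" "?k h < ?k y" using kless[of x h] kless[of h y] h hy False by auto
          then show ?thesis using h by blast
        qed
      qed
      then obtain j where "v x < v j" "?k x < ?k j" "?k j \<le> ?k y" by (auto simp: le_less)
      then have "?w (?k x) < ?w (?k j) \<and> ?k x < ?k j \<and> ?k j \<le> ?k y" unfolding wk by simp
      then show ?thesis unfolding pops_before_def by (meson order.strict_trans2)
    qed
  next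
    case False
    then have yx: "y < x" and small: "\<And>h. y < h \<Longrightarrow> h \<le> x \<Longrightarrow> v h < v y"
      using pb by (auto simp: pops_before_def)
    have "\<not> blk y x" using blk_v[of y x] small[of x] yx by auto
    then have kyx: "?k y < ?k x" using kless[of y x] yx by blast
    have "?w i < ?w (?k y)" if i: "?k y < i" "i \<le> ?k x" for i
    proof -
      obtain j where j: "i = ?k j" using surj by blast
      have 1: "y < j \<and> \<not> blk y j \<or> blk j y" using i j kless[of y j] by blast
      have 2: "x = j \<or> j < x \<and> \<not> blk j x \<or> blk x j"
        using i j kless[of j x] affine_perms_inj[OF k, of j x] by linarith
      have "v j < v y"
      proof (cases "blk j y")
        case True
        then show ?thesis by (rule blk_v)
      next
        case False
        then have yj: "y < j" "\<not> blk y j" using 1 by auto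
        show ?thesis
        proof (cases "j \<le> x")
          case True
          then show ?thesis using small yj by blast
        next
          case False
          then have "blk x j" using 2 by auto
          then obtain m where m: "j = q + m * int n" "p + m * int n \<le> x" "x < j" by (auto simp: blk_def)
          \<comment> \<open>A moved element has entered the range that \<open>y\<close> must
            dominate. Since \<open>y\<close> stands left of the window and sees its first element,
            the left child condition makes it larger than the moved element.\<close>
          then have "y < p + m * int n" using yj by (auto simp: blk_def)
          then show ?thesis using left'[of y m] small m by auto
        qed
      qed
      then show ?thesis unfolding j wk .
    qed
    then show ?thesis using kyx unfolding pops_before_def by blast
  qed
  show ?thesis
  proof (cases "x = y")
    case True
    then show ?thesis by (simp add: pops_before_def)
  next
    case False
    then have "?k x \<noteq> ?k y" using affine_perms_inj[OF k] by simp
    then show ?thesis using imp[of x y] imp[of y x] pops_before_total[OF v False]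
        pops_before_total[OF w] by blast
  qed
qed

text \<open>The rotation preserves the postorder, so \<open>pi_down\<close> gets composed with the
  same relabelling as \<open>v\<close>, and the relabelling cancels in the quotient.\<close>

lemma affine_stack_sort_window_rotation:
  assumes n: "n \<ge> 2" and v: "v \<in> affine_perms n" and pq: "p < q" "q < p + int n"
    and "\<And>j. p < j \<Longrightarrow> j < q \<Longrightarrow> v j < v p"
    and "v p < v q" "v p < v (q + 1)"
    and "\<And>j. j < p \<Longrightarrow> v p < v j \<Longrightarrow> (\<And>k. j < k \<Longrightarrow> k < p \<Longrightarrow> v k < v j) \<Longrightarrow> v q < v j"
  shows "affine_stack_sort n (v \<circ> inv (window_rotation n p q)) = affine_stack_sort n v"
proof -
  let ?k = "window_rotation n p q"
  have n0: "n > 0" using n by simp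
  have k: "?k \<in> affine_perms n" by (rule window_rotation_affine_perms[OF pq])
  have ki: "inv ?k \<in> affine_perms n" by (rule affine_perms_inverse[OF n0 k])
  have w: "v \<circ> inv ?k \<in> affine_perms n" by (rule affine_perms_comp[OF n0 v ki])
  let ?u = "pi_down n v"
  have u: "?u \<in> affine_perms n" by (rule pi_down_pops_before(1)[OF n v])
  have pb: "pops_before v x y \<longleftrightarrow> pops_before (v \<circ> inv ?k) (?k x) (?k y)" for x y
    by (rule pops_before_window_rotation; fact)
  have "pi_down n (v \<circ> inv ?k) = ?u \<circ> inv ?k"
  proof (rule pi_down_eqI[OF n w affine_perms_comp[OF n0 u ki]])
    fix x y assume "(?u \<circ> inv ?k) x < (?u \<circ> inv ?k) y"
    then have "pops_before v (inv ?k x) (inv ?k y)" using pi_down_pops_before(2)[OF n v] by simp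
    then show "pops_before (v \<circ> inv ?k) x y"
      using pb[of "inv ?k x" "inv ?k y"] k by simp
  qed
  moreover have "inv (?u \<circ> inv ?k) = ?k \<circ> inv ?u"
    using o_inv_distrib[OF affine_perms_bij[OF u] affine_perms_bij[OF ki]] 
      inv_inv_eq[OF affine_perms_bij[OF k]] by simp
  moreover have "v \<circ> inv ?k \<circ> (?k \<circ> inv ?u) = v \<circ> inv ?u" using k by (auto simp: fun_eq_iff)
  ultimately show ?thesis by (simp only: affine_stack_sort_def)
qed

section \<open>Second preimages obtained from a delay or from a double ascent\<close>

lemma window_rotation_lower:
  assumes "p < q" "q < p + int n"
  shows "window_rotation n p q x < p \<longleftrightarrow> x < p"
proof -
  have n: "int n > 0" using assms by linarith
  define a r where "a = (x - p) div int n" "r = (x - p) mod int n"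
  have x: "x = p + a * int n + r" and r: "0 \<le> r" "r < int n" using n by (simp_all add: a_r_def)
  show ?thesis
  proof (cases "a < 0")
    case True
    then have "(a + 1) * int n \<le> 0" using n by (simp add: mult_le_0_iff)
    then have "a * int n + int n \<le> 0" by (simp add: algebra_simps)
    then show ?thesis using x r assms unfolding window_rotation_def a_r_def(2)[symmetric] by auto
  next
    case False
    then have "0 \<le> a * int n" by simp
    then show ?thesis using x r assms unfolding window_rotation_def a_r_def(2)[symmetric] by auto
  qed
qed

text \<open>The value at \<open>p\<close> is moved to the right, past \<open>p + 1\<close> and its
  right subtree; this undoes a rotation. The hypothesis on the left says that no element still
  waiting on the stack has its value between \<open>v (p + 1)\<close> and \<open>v p\<close>, so
  that after the move \<open>p\<close> carries the left child of \<open>q\<close>.\<close>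

lemma affine_stack_sort_delay:
  assumes n: "n \<ge> 2" and v: "v \<in> affine_perms n" and desc: "v (p + 1) < v p"
    and left: "\<And>j. j < p \<Longrightarrow> v (p + 1) < v j \<Longrightarrow> (\<And>k. j < k \<Longrightarrow> k < p \<Longrightarrow> v k < v j) \<Longrightarrow> v p < v j"
  shows "\<exists>w \<in> affine_perms n. w \<noteq> v \<and> affine_stack_sort n w = affine_stack_sort n v"
proof -
  have n0: "n > 0" using n by simp
  \<comment> \<open>Periodicity provides a larger value at \<open>p + n\<close>, so the right
    subtree of \<open>p + 1\<close> ends before it and the window is shorter than a period.\<close>
  have "v (p + 1) < v (p + int n)" using desc affine_perms_shift1[OF v, of p] by simp
  then have "\<exists>d. v (p + 1) < v (p + 2 + int d)" using n by (intro exI[of _ "n - 2"]) (simp add: of_nat_diff)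
  then obtain d where d: "v (p + 1) < v (p + 2 + int d)" "\<And>e. e < d \<Longrightarrow> \<not> v (p + 1) < v (p + 2 + int e)"
    using exists_least_iff[of "\<lambda>d. v (p + 1) < v (p + 2 + int d)"] by blast
  define q where "q = p + 1 + int d"
  have "d \<le> n - 2"
  proof (rule ccontr)
    assume "\<not> d \<le> n - 2"
    then have "\<not> v (p + 1) < v (p + 2 + int (n - 2))" using d(2)[of "n - 2"] by linarith
    then show False using \<open>v (p + 1) < v (p + int n)\<close> n by (simp add: of_nat_diff)
  qed
  then have pq: "p < q" "q < p + int n" using n by (simp_all add: q_def)
  have inner: "v (j + 1) < v (p + 1)" if "p < j" "j < q" for j
  proof -
    have "\<not> v (p + 1) < v (p + 2 + int (nat (j - p - 1)))"
      by (rule d(2)) (use that in \<open>simp add: q_def\<close>)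
    then have "\<not> v (p + 1) < v (j + 1)" using that by (simp add: algebra_simps)
    moreover have "v (p + 1) \<noteq> v (j + 1)" using affine_perms_inj[OF v] that by simp
    ultimately show ?thesis by simp
  qed
  have vq: "v (p + 1) < v (q + 1)" using d(1) by (simp add: q_def algebra_simps)
  let ?k = "window_rotation n p q"
  define w where "w = v \<circ> ?k"
  have k: "?k \<in> affine_perms n" by (rule window_rotation_affine_perms[OF pq])
  have w: "w \<in> affine_perms n" unfolding w_def by (rule affine_perms_comp[OF n0 v k])
  have kin: "?k x = x + 1" if "p \<le> x" "x < q" for x
    using that pq by (simp add: window_rotation_def)
  have kq: "?k q = p" using pq by (simp add: window_rotation_def)
  have wp: "w p = v (p + 1)" "w q = v p" using kin[of p] kq pq by (simp_all add: w_def)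
  have inner': "w j < w p" if "p < j" "j < q" for j
    using inner[OF that] kin[of j] that wp by (simp add: w_def)
  have wq: "w p < w q" using wp desc by simp
  have wq1: "w p < w (q + 1)"
  \<comment> \<open>The position \<open>q + 1\<close> may already be the start of the next window,
    where \<open>w\<close> takes the value \<open>w p + n\<close>.\<close>
  proof (cases "q + 1 = p + int n")
    case True
    then show ?thesis using affine_perms_shift1[OF w, of p] n0 by simp
  next
    case False
    then have "q + 1 - p < int n" using pq by simp
    then have "?k (q + 1) = q + 1" using pq by (simp add: window_rotation_def)
    then show ?thesis using vq wp by (simp add: w_def)
  qed
  have "affine_stack_sort n (w \<circ> inv ?k) = affine_stack_sort n w"
  proof (rule affine_stack_sort_window_rotation)
    fix j assume j: "j < p" "w p < w j" "\<And>k. j < k \<Longrightarrow> k < p \<Longrightarrow> w k < w j"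
    have "v p < v (?k j)"
    proof (rule left)
      show "?k j < p" using window_rotation_lower[OF pq] j(1) by simp
      show "v (p + 1) < v (?k j)" using j(2) wp by (simp add: w_def)
      fix i assume i: "?k j < i" "i < p"
      define h where "h = inv ?k i"
      have ih: "i = ?k h" using k by (simp add: h_def)
      have "h < p" using window_rotation_lower[OF pq, of h] i ih by simp
      have "w h < w j"
      proof (cases "j < h")
        case True
        then show ?thesis using j(3) \<open>h < p\<close> by blast
      next
        case False
        \<comment> \<open>If \<open>h\<close> stands left of \<open>j\<close> but lands to its
          right, then \<open>j\<close> is the moved position of a window containing
          \<open>h\<close>, and the maximum of \<open>w\<close> on that window is at its right
          end.\<close>
        moreover have "j \<noteq> h" using i ih by auto
        ultimately obtain m where m: "j = q + m * int n" "p + m * int n \<le> h" "h < j"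
          using window_rotation_less[OF pq, of j h] i ih by auto
        define h' where "h' = h - m * int n"
        have h': "p \<le> h'" "h' < q" using m by (auto simp: h'_def)
        then have "w h' < w q" using inner'[of h'] wq by (cases "h' = p") auto
        then show ?thesis using affine_perms_shift[OF w, of h' m] affine_perms_shift[OF w, of q m] m
          by (simp add: h'_def)
      qed
      then show "v i < v (?k j)" using ih by (simp add: w_def)
    qed
    then show "w q < w j" using wp by (simp add: w_def)
  qed fact+
  moreover have "w \<circ> inv ?k = v" using k by (auto simp: w_def)
  moreover have "w \<noteq> v" using wp desc by auto
  ultimately show ?thesis using w by metis
qed

text \<open>A double ascent at \<open>q\<close> has a left child \<open>p\<close> and no right
  child, and the positions between \<open>p\<close> and \<open>q\<close> form the right subtree of
  \<open>p\<close>. Moving \<open>q\<close> in front of \<open>p\<close> is then a rotation of the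
  required kind.\<close>

lemma affine_stack_sort_double_ascent:
  assumes n: "n \<ge> 2" and v: "v \<in> affine_perms n" and asc: "v (q - 1) < v q" "v q < v (q + 1)"
  shows "\<exists>w \<in> affine_perms n. w \<noteq> v \<and> affine_stack_sort n w = affine_stack_sort n v"
proof -
  have n0: "n > 0" using n by simp
  define S where "S j \<longleftrightarrow> j < q \<and> (\<forall>k. j \<le> k \<and> k < q \<longrightarrow> v k < v q)" for j
  have "S (q - 1)"
    unfolding S_def
  proof (intro conjI allI impI)
    fix k assume "q - 1 \<le> k \<and> k < q"
    then have "k = q - 1" by simp
    then show "v k < v q" using asc by simp
  qed simp
  \<comment> \<open>The left subtree of \<open>q\<close> may be infinite, so its maximum is found as
    the least difference from \<open>v q\<close>.\<close>
  then obtain p where p: "S p" "\<And>j. S j \<Longrightarrow> nat (v q - v p) \<le> nat (v q - v j)"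
    using ex_has_least_nat[of S "q - 1" "\<lambda>j. nat (v q - v j)"] by blast
  have S_lt: "v j < v q" if "S j" for j using that by (auto simp: S_def)
  have max: "v j \<le> v p" if "S j" for j using p(2)[OF that] S_lt[OF that] S_lt[OF p(1)] by linarith
  have S_mono: "S j" if "p \<le> j" "j < q" for j using p(1) that by (auto simp: S_def)
  have inner: "v j < v p" if "p < j" "j < q" for j
    using max[OF S_mono[of j]] affine_perms_inj[OF v, of j p] that by simp
  have pq: "p < q" using p(1) by (simp add: S_def)
  have vq: "v p < v q" "v p < v (q + 1)" using S_lt[OF p(1)] asc by auto
  \<comment> \<open>If \<open>p + n\<close> were left of \<open>q\<close>, it would exceed the
    maximum at \<open>p\<close>. If it were \<open>q\<close>, the ascent after \<open>q\<close>
    would be a translate of an ascent after \<open>p\<close>.\<close>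
  have qn: "q < p + int n"
  proof (rule ccontr)
    assume "\<not> q < p + int n"
    then consider "p + int n < q" | "q = p + int n" by linarith
    then show False
    proof cases
      case 1
      then have "v (p + int n) \<le> v p" using max S_mono by simp
      then show False using affine_perms_shift1[OF v] n0 by simp
    next
      case 2
      have "v (q + 1) = v (p + 1) + int n"
        using affine_perms_shift1[OF v, of "p + 1"] 2 by (simp add: algebra_simps)
      then have "v p < v (p + 1)" using asc 2 affine_perms_shift1[OF v] by simp
      moreover have "v (p + 1) \<le> v p" using max S_mono 2 n by simp
      ultimately show False by simp
    qed
  qed
  have left: "v q < v j" if "j < p" "v p < v j" "\<And>k. j < k \<Longrightarrow> k < p \<Longrightarrow> v k < v j" for j
  proof (rule ccontr)
    assume "\<not> v q < v j"
    moreover have "v q \<noteq> v j" using affine_perms_inj[OF v] that(1) pq by simp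
    ultimately have jq: "v j < v q" by simp
    have "v k < v q" if "j \<le> k" "k < q" for k
    proof -
      consider "k = j" | "j < k" "k < p" | "p \<le> k" using \<open>j \<le> k\<close> by linarith
      then show ?thesis
        using jq \<open>\<And>k. j < k \<Longrightarrow> k < p \<Longrightarrow> v k < v j\<close>[of k] S_lt[OF S_mono[of k]] \<open>k < q\<close>
        by cases auto
    qed
    then have "S j" using that(1) pq by (simp add: S_def)
    then show False using max that(2) by force
  qed
  let ?k = "window_rotation n p q"
  have k: "?k \<in> affine_perms n" by (rule window_rotation_affine_perms[OF pq qn])
  have "affine_stack_sort n (v \<circ> inv ?k) = affine_stack_sort n v"
    by (rule affine_stack_sort_window_rotation; fact)
  moreover have "v \<circ> inv ?k \<in> affine_perms n"
    by (rule affine_perms_comp[OF n0 v affine_perms_inverse[OF n0 k]])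
  moreover have "?k q = p" using pq qn by (simp add: window_rotation_def)
  then have "inv ?k p = q" using affine_perms_inv(2)[OF k, of q] by simp
  then have "v \<circ> inv ?k \<noteq> v" using vq by (metis comp_apply less_irrefl)
  ultimately show ?thesis by blast
qed

section \<open>Descents and valleys\<close>

definition valley :: "(int \<Rightarrow> int) \<Rightarrow> int \<Rightarrow> bool" where
  "valley v y \<longleftrightarrow> v y < v (y - 1) \<and> v y < v (y + 1)"

lemma valley_shift:
  assumes "v \<in> affine_perms n"
  shows "valley v (y + m * int n) \<longleftrightarrow> valley v y"
  using affine_perms_shift[OF assms, of y m] affine_perms_shift[OF assms, of "y + 1" m]
    affine_perms_shift[OF assms, of "y - 1" m]
  by (simp add: valley_def algebra_simps)

lemma valley_mod:
  assumes "v \<in> affine_perms n"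
  shows "valley v (y mod int n) \<longleftrightarrow> valley v y"
  using valley_shift[OF assms, of "y mod int n" "y div int n"] by simp

lemma card_eq_iff_eq: "finite B \<Longrightarrow> A \<subseteq> B \<Longrightarrow> card A = card B \<longleftrightarrow> A = B"
  by (metis card_subset_eq)

text \<open>The residues of valleys and of their right neighbours are disjoint sets of the same
  size; equality means that together they exhaust a period.\<close>

lemma card_valleys:
  assumes n: "n > 0" and v: "v \<in> affine_perms n"
  shows "2 * card {r \<in> {0..<int n}. valley v r} \<le> n"
    "2 * card {r \<in> {0..<int n}. valley v r} = n \<longleftrightarrow> (\<forall>y. valley v y \<or> valley v (y - 1))"
proof -
  let ?A = "{r \<in> {0..<int n}. valley v r}"
  let ?B = "{r \<in> {0..<int n}. valley v (r - 1)}"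
  have "bij_betw (\<lambda>r. (r + 1) mod int n) ?A ?B"
  proof (rule bij_betw_byWitness[where f' = "\<lambda>r. (r - 1) mod int n"])
    show "(\<lambda>r. (r + 1) mod int n) ` ?A \<subseteq> ?B"
    proof (rule image_subsetI)
      fix r assume "r \<in> ?A"
      then have "valley v (((r + 1) mod int n - 1) mod int n)"
        using valley_mod[OF v, of r] by (simp add: mod_diff_left_eq)
      then show "(r + 1) mod int n \<in> ?B" using valley_mod[OF v, of "(r + 1) mod int n - 1"] n by simp
    qed
    show "(\<lambda>r. (r - 1) mod int n) ` ?B \<subseteq> ?A" using n valley_mod[OF v] by auto
  qed (simp_all add: mod_diff_left_eq mod_add_left_eq)
  then have c: "card ?A = card ?B" by (rule bij_betw_same_card)
  have "?A \<inter> ?B = {}" by (auto simp: valley_def)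
  moreover have "finite ?A" "finite ?B" by (rule finite_subset[of _ "{0..<int n}"]; auto)+
  ultimately have u: "card (?A \<union> ?B) = 2 * card ?A" using c by (simp add: card_Un_disjoint)
  have sub: "?A \<union> ?B \<subseteq> {0..<int n}" by auto
  show "2 * card ?A \<le> n" using card_mono[OF _ sub] u by simp
  have "2 * card ?A = n \<longleftrightarrow> card (?A \<union> ?B) = card {0..<int n}" unfolding u by simp
  also have "\<dots> \<longleftrightarrow> ?A \<union> ?B = {0..<int n}"
    by (rule card_eq_iff_eq[OF finite_atLeastLessThan_int sub])
  also have "\<dots> \<longleftrightarrow> (\<forall>y. valley v y \<or> valley v (y - 1))"
  proof
    assume eq: "?A \<union> ?B = {0..<int n}"
    show "\<forall>y. valley v y \<or> valley v (y - 1)"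
    proof
      fix y
      have "y mod int n \<in> ?A \<union> ?B" unfolding eq using n by simp
      then have "valley v (y mod int n) \<or> valley v ((y mod int n - 1) mod int n)"
        using valley_mod[OF v] by auto
      then show "valley v y \<or> valley v (y - 1)" using valley_mod[OF v] by (simp add: mod_diff_left_eq)
    qed
  qed auto
  finally show "2 * card ?A = n \<longleftrightarrow> (\<forall>y. valley v y \<or> valley v (y - 1))" .
qed

text \<open>A descent is recorded at the position that \<open>u\<close> sends to its right end
  \<open>i + 1\<close>. This makes descents of the sorted word comparable with valleys, which are
  positions of the original word.\<close>

lemma card_descents:
  assumes n: "n \<ge> 2" and w: "w \<in> affine_perms n" and u: "u \<in> affine_perms n"
  shows "card (descents n w) = card {r \<in> {0..<int n}. w (u r) < w (u r - 1)}"
proof -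
  have n0: "n > 0" using n by simp
  let ?D = "{i \<in> {1..int n}. w (i + 1) < w i}"
  have "inj_on (affine_simple n) ?D"
  proof (rule inj_onI)
    fix i j assume ij: "i \<in> ?D" "j \<in> ?D" "affine_simple n i = affine_simple n j"
    have "affine_simple n i i = i + 1" by (simp add: affine_simple_def)
    then have "affine_simple n j i = i + 1" using ij by simp
    then have "int n dvd i - j" by (auto simp: affine_simple_def split: if_splits)
    then show "i = j" using ij(1,2) zdvd_not_zless[of "i - j" "int n"] zdvd_not_zless[of "j - i" "int n"]
      by (cases i j rule: linorder_cases) (auto simp: dvd_diff_commute)
  qed
  moreover have "descents n w = affine_simple n ` ?D" by (auto simp: descents_def)
  ultimately have "card (descents n w) = card ?D" by (simp add: card_image)
  also have "bij_betw (\<lambda>i. inv u (i + 1) mod int n) ?D {r \<in> {0..<int n}. w (u r) < w (u r - 1)}"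
  proof (rule bij_betw_Collect)
    have "inj (\<lambda>i. inv u (i + 1))"
      using affine_perms_inj[OF affine_perms_inverse[OF n0 u]] by (auto simp: inj_def)
    moreover have "inv u (i + int n + 1) = inv u (i + 1) + int n" for i
      using affine_perms_shift1[OF affine_perms_inverse[OF n0 u], of "i + 1"] by (simp add: algebra_simps)
    ultimately show "bij_betw (\<lambda>i. inv u (i + 1) mod int n) {1..int n} {0..<int n}"
      using bij_betw_residues[OF n0] by blast
    fix i
    define m where "m = inv u (i + 1) div int n"
    have "inv u (i + 1) mod int n = inv u (i + 1) + (- m) * int n"
      by (simp add: m_def minus_div_mult_eq_mod[symmetric])
    then have "u (inv u (i + 1) mod int n) = i + 1 + (- m) * int n"
      using affine_perms_shift[OF u, of "inv u (i + 1)" "- m"] u by simp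
    then show "w (u (inv u (i + 1) mod int n)) < w (u (inv u (i + 1) mod int n) - 1) \<longleftrightarrow> w (i + 1) < w i"
      using affine_perms_shift[OF w, of "i + 1" "- m"] affine_perms_shift[OF w, of i "- m"] by simp
  qed
  then have "card ?D = card {r \<in> {0..<int n}. w (u r) < w (u r - 1)}" by (rule bij_betw_same_card)
  finally show ?thesis .
qed

section \<open>The postorder numbering of a fixed permutation\<close>

context
  fixes n :: nat and v u :: "int \<Rightarrow> int"
  assumes n: "n \<ge> 2" and v: "v \<in> affine_perms n"
  defines "u \<equiv> pi_down n v"
begin

private lemma u: "u \<in> affine_perms n"
  unfolding u_def by (rule pi_down_pops_before(1)[OF n v])

private lemma u_less: "u x < u y \<longleftrightarrow> pops_before v x y"
  unfolding u_def by (rule pi_down_pops_before(2)[OF n v])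

lemma pi_down_between:
  assumes "x < y" "u y < u x" "x < k" "k \<le> y"
  shows "v k < v x"
  using assms u_less[of y x] by (auto simp: pops_before_def)

lemma pi_down_leaf:
  assumes "v x < v (x + 1)" "x < y"
  shows "u x < u y"
  using assms u_less[of x y] by (auto simp: pops_before_def intro: exI[of _ "x + 1"])

lemma pi_down_right_child:
  assumes "v (x + 1) < v x"
  shows "u (x + 1) < u x"
  using assms u_less[of "x + 1" x] by (auto simp: pops_before_def) (metis zless_add1_eq linorder_not_less order_antisym_conv order_less_le)

lemma affine_stack_sort_pi_down: "affine_stack_sort n v (u x) = v x"
  using affine_perms_inv(2)[OF u, of x] by (simp add: affine_stack_sort_def u_def)

lemma affine_stack_sort_affine_perms: "affine_stack_sort n v \<in> affine_perms n"
  unfolding affine_stack_sort_def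
  using affine_perms_comp[OF _ v affine_perms_inverse[OF _ u]] n by (simp add: u_def)

text \<open>Let \<open>x\<close> immediately precede \<open>y\<close> in the postorder. A smaller
  neighbour of \<open>y\<close> on either side would be popped before \<open>y\<close>, hence before
  \<open>x\<close>; then \<open>x\<close> would dominate everything up to that neighbour, against
  the larger element \<open>k\<close> that causes \<open>x\<close> to be popped.\<close>

lemma descent_valley:
  assumes "affine_stack_sort n v (u y) < affine_stack_sort n v (u y - 1)"
  shows "valley v y"
proof -
  define x where "x = inv u (u y - 1)"
  have x: "u x = u y - 1" using u by (simp add: x_def)
  have vyx: "v y < v x" using assms affine_stack_sort_pi_down[of y] affine_stack_sort_pi_down[of x] x by simp
  have "x < y"
  proof (rule ccontr)
    assume "\<not> x < y"
    then have "y < x" using x by (cases x y rule: linorder_cases) auto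
    then show False using pi_down_between[of y x x] x vyx by simp
  qed
  moreover have "pops_before v x y" using u_less[of x y] x by simp
  ultimately obtain k where k: "x < k" "k \<le> y" "v x < v k" by (auto simp: pops_before_def)
  then have "k \<noteq> y" using vyx by auto
  have "\<not> v (y + 1) < v y"
  proof
    assume "v (y + 1) < v y"
    then have "u (y + 1) < u x" using pi_down_right_child[of y] x affine_perms_inj[OF u, of "y + 1" x] \<open>x < y\<close> by simp
    then show False using pi_down_between[of x "y + 1" k] k \<open>x < y\<close> by simp
  qed
  moreover have "\<not> v (y - 1) < v y"
  proof
    assume "v (y - 1) < v y"
    then have "u (y - 1) < u y" using pi_down_leaf[of "y - 1" y] by simp
    moreover have "y - 1 \<noteq> x" using \<open>v (y - 1) < v y\<close> vyx by auto
    ultimately have "u (y - 1) < u x" "x < y - 1"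
      using x affine_perms_inj[OF u, of "y - 1" x] \<open>x < y\<close> by auto
    then show False using pi_down_between[of x "y - 1" k] k \<open>k \<noteq> y\<close> by simp
  qed
  moreover have "v y \<noteq> v (y + 1)" "v y \<noteq> v (y - 1)" using affine_perms_inj[OF v] by auto
  ultimately show ?thesis by (simp add: valley_def)
qed

lemma card_descents_valleys:
  "card (descents n (affine_stack_sort n v)) \<le> card {r \<in> {0..<int n}. valley v r}"
  "card (descents n (affine_stack_sort n v)) = card {r \<in> {0..<int n}. valley v r} \<longleftrightarrow>
    (\<forall>y. valley v y \<longrightarrow> affine_stack_sort n v (u y) < affine_stack_sort n v (u y - 1))"
proof -
  let ?w = "affine_stack_sort n v"
  let ?D = "{r \<in> {0..<int n}. ?w (u r) < ?w (u r - 1)}"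
  let ?V = "{r \<in> {0..<int n}. valley v r}"
  have c: "card (descents n ?w) = card ?D"
    by (rule card_descents[OF n affine_stack_sort_affine_perms u])
  have sub: "?D \<subseteq> ?V" using descent_valley by blast
  have fin: "finite ?V" by (rule finite_subset[of _ "{0..<int n}"]) auto
  show "card (descents n ?w) \<le> card ?V" unfolding c by (rule card_mono[OF fin sub])
  have "card (descents n ?w) = card ?V \<longleftrightarrow> ?D = ?V" unfolding c
    by (rule card_eq_iff_eq[OF fin sub])
  also have "\<dots> \<longleftrightarrow> (\<forall>y. valley v y \<longrightarrow> ?w (u y) < ?w (u y - 1))"
  proof
    assume eq: "?D = ?V"
    show "\<forall>y. valley v y \<longrightarrow> ?w (u y) < ?w (u y - 1)"
    proof (intro allI impI)
      fix y assume "valley v y"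
      then have "y mod int n \<in> ?V" using valley_mod[OF v] n by simp
      then have lt: "?w (u (y mod int n)) < ?w (u (y mod int n) - 1)" unfolding eq[symmetric] by simp
      define m where "m = y div int n"
      have y: "y = y mod int n + m * int n" by (simp add: m_def)
      then have "u y = u (y mod int n) + m * int n" using affine_perms_shift[OF u, of "y mod int n" m] by simp
      then show "?w (u y) < ?w (u y - 1)"
        using lt affine_perms_shift[OF affine_stack_sort_affine_perms, of "u (y mod int n)" m]
          affine_perms_shift[OF affine_stack_sort_affine_perms, of "u (y mod int n) - 1" m]
        by (simp add: algebra_simps)
    qed
  qed (use descent_valley in blast)
  finally show "card (descents n ?w) = card ?V \<longleftrightarrow>
    (\<forall>y. valley v y \<longrightarrow> ?w (u y) < ?w (u y - 1))" .
qed

lemma affine_stack_sort_double_descent: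
  assumes "v p < v (p - 1)" "v (p + 1) < v p"
  shows "\<exists>w \<in> affine_perms n. w \<noteq> v \<and> affine_stack_sort n w = affine_stack_sort n v"
proof (rule affine_stack_sort_delay[OF n v assms(2)])
  fix j assume "j < p" "\<And>k. j < k \<Longrightarrow> k < p \<Longrightarrow> v k < v j"
  \<comment> \<open>Any waiting element either stands at \<open>p - 1\<close> or exceeds the value
    there, which is already larger than \<open>v p\<close>.\<close>
  from this(1) this(2)[of "p - 1"] show "v p < v j" using assms(1) by (cases "j = p - 1") auto
qed

text \<open>The element at \<open>y - 1\<close> can be delayed unless a waiting \<open>j\<close> has
  its value between \<open>v y\<close> and \<open>v (y - 1)\<close>. Such a \<open>j\<close> is
  popped before \<open>y\<close>, hence before the predecessor \<open>c\<close> of \<open>y\<close>.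
  But \<open>c\<close> is smaller than \<open>j\<close>: right of \<open>j\<close> it is a
  descendant of \<open>j\<close>, and left of \<open>j\<close> it cannot wait for
  \<open>j\<close>.\<close>

lemma affine_stack_sort_ascent_valley:
  assumes val: "valley v y" and asc: "affine_stack_sort n v (u y - 1) \<le> affine_stack_sort n v (u y)"
  shows "\<exists>w \<in> affine_perms n. w \<noteq> v \<and> affine_stack_sort n w = affine_stack_sort n v"
proof (rule affine_stack_sort_delay[OF n v, of "y - 1"])
  show "v (y - 1 + 1) < v (y - 1)" using val by (simp add: valley_def)
  define c where "c = inv u (u y - 1)"
  have c: "u c = u y - 1" using u by (simp add: c_def)
  have vc: "v c < v y"
    using asc affine_stack_sort_pi_down[of y] affine_stack_sort_pi_down[of c] c
      affine_perms_inj[OF v, of c y] by (cases "c = y") auto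
  fix j assume j: "j < y - 1" "v (y - 1 + 1) < v j" "\<And>k. j < k \<Longrightarrow> k < y - 1 \<Longrightarrow> v k < v j"
  show "v (y - 1) < v j"
  proof (rule ccontr)
    assume "\<not> v (y - 1) < v j"
    then have "v j < v (y - 1)" using affine_perms_inj[OF v, of "y - 1" j] j(1) by simp
    then have "u j < u y" using u_less[of j y] j(1) by (auto simp: pops_before_def intro!: exI[of _ "y - 1"])
    moreover have "c \<noteq> j" using vc j(2) by auto
    ultimately have ujc: "u j < u c" using c affine_perms_inj[OF u, of j c] by simp
    have "c < y"
    proof (rule ccontr)
      assume "\<not> c < y"
      then have "y < c" using c by (cases c y rule: linorder_cases) auto
      then show False using pi_down_leaf[of y c] c val by (simp add: valley_def)
    qed
    moreover have "u y < u (y - 1)" using pi_down_right_child[of "y - 1"] val by (simp add: valley_def)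
    then have "c \<noteq> y - 1" using c by auto
    ultimately have "c < y - 1" by simp
    consider "j < c" | "c < j" using \<open>c \<noteq> j\<close> by linarith
    then show False
    proof cases
      case 1
      then have "pops_before v c j" using j(3) \<open>c < y - 1\<close> by (auto simp: pops_before_def)
      then show False using u_less[of c j] ujc by simp
    next
      case 2
      then show False using pi_down_between[of c j j] ujc vc j(2) by simp
    qed
  qed
qed

lemma unique_preimage_valleys:
  assumes uniq: "\<And>w. w \<in> affine_perms n \<Longrightarrow> affine_stack_sort n w = affine_stack_sort n v \<Longrightarrow> w = v"
  shows "2 * card (descents n (affine_stack_sort n v)) = n"
proof -
  have no: "\<not> (\<exists>w \<in> affine_perms n. w \<noteq> v \<and> affine_stack_sort n w = affine_stack_sort n v)"
    using uniq by blast
  have ne: "v (y + 1) \<noteq> v y" "v (y - 1) \<noteq> v y" for y using affine_perms_inj[OF v] by auto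
  have dd: "\<not> (v y < v (y - 1) \<and> v (y + 1) < v y)" for y
    using affine_stack_sort_double_descent no by blast
  have aa: "\<not> (v (y - 1) < v y \<and> v y < v (y + 1))" for y
    using affine_stack_sort_double_ascent[OF n v] no by blast
  have "valley v y \<or> valley v (y - 1)" for y
    using dd[of y] dd[of "y - 1"] aa[of y] aa[of "y - 1"] ne[of y] ne[of "y - 1"]
    by (auto simp: valley_def)
  then have "2 * card {r \<in> {0..<int n}. valley v r} = n" using card_valleys(2)[OF _ v] n by simp
  moreover have "\<forall>y. valley v y \<longrightarrow> affine_stack_sort n v (u y) < affine_stack_sort n v (u y - 1)"
    using affine_stack_sort_ascent_valley no linorder_not_le by blast
  then have "card (descents n (affine_stack_sort n v)) = card {r \<in> {0..<int n}. valley v r}"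
    using card_descents_valleys(2) by blast
  ultimately show ?thesis by simp
qed

lemma max_descents_valleys:
  assumes "2 * card (descents n (affine_stack_sort n v)) = n"
  shows "valley v (y + 1) \<longleftrightarrow> \<not> valley v y"
    "valley v y \<longleftrightarrow> affine_stack_sort n v (u y) < affine_stack_sort n v (u y - 1)"
proof -
  have c: "card (descents n (affine_stack_sort n v)) = card {r \<in> {0..<int n}. valley v r}"
    "2 * card {r \<in> {0..<int n}. valley v r} = n"
    using assms card_descents_valleys(1) card_valleys(1)[OF _ v] n by linarith+
  have "\<not> (valley v (y + 1) \<and> valley v y)" by (auto simp: valley_def)
  then show "valley v (y + 1) \<longleftrightarrow> \<not> valley v y"
    using c(2) card_valleys(2)[OF _ v] n by (metis add_diff_cancel_right' zero_less_iff_neq_zero not_numeral_le_zero)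
  show "valley v y \<longleftrightarrow> affine_stack_sort n v (u y) < affine_stack_sort n v (u y - 1)"
    using c(1) card_descents_valleys(2) descent_valley by blast
qed

end

section \<open>Uniqueness of the preimage\<close>

text \<open>With the elements of \<open>E\<close> as opening and the other numbers as closing
  parentheses, \<open>u x\<close> is the first number at which the openings counted from
  \<open>u (x + 1)\<close> no longer exceed the closings. Since \<open>E\<close> depends only on the
  sorted permutation, it determines \<open>u x\<close> from \<open>u (x + 1)\<close>.\<close>

lemma ballot:
  assumes n: "n \<ge> 2" and v: "v \<in> affine_perms n"
    and max: "2 * card (descents n (affine_stack_sort n v)) = n" and x: "\<not> valley v x"
  defines "u \<equiv> pi_down n v"
  defines "E \<equiv> {s. affine_stack_sort n v s < affine_stack_sort n v (s - 1)}"
  shows "card ({u (x + 1)..u x} \<inter> E) \<le> card ({u (x + 1)..u x} - E)"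
    "\<And>t. u (x + 1) \<le> t \<Longrightarrow> t < u x \<Longrightarrow> card ({u (x + 1)..t} - E) < card ({u (x + 1)..t} \<inter> E)"
proof -
  note valleys = max_descents_valleys[OF n v max]
  have E: "u y \<in> E \<longleftrightarrow> valley v y" for y using valleys(2)[of y] by (simp add: E_def u_def)
  have succ: "valley v (y + 1) \<longleftrightarrow> \<not> valley v y" for y by (rule valleys(1))
  have pred: "valley v (y - 1) \<longleftrightarrow> \<not> valley v y" for y using succ[of "y - 1"] by auto
  have u: "u \<in> affine_perms n" unfolding u_def by (rule pi_down_pops_before(1)[OF n v])
  have less: "u a < u b \<longleftrightarrow> pops_before v a b" for a b
    unfolding u_def by (rule pi_down_pops_before(2)[OF n v])
  note between = pi_down_between[OF n v, folded u_def]
  have leaf: "u a < u b" if "valley v a" "a < b" for a b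
    using pi_down_leaf[OF n v, of a b] that by (simp add: u_def valley_def)
  have peak: "u (a + 1) < u a" if "\<not> valley v a" for a
    using pi_down_right_child[OF n v, of a] succ[of a] that by (simp add: u_def valley_def)
  \<comment> \<open>A position left of \<open>x\<close> that is popped after \<open>x + 1\<close>
    dominates everything up to \<open>x + 1\<close>. It is then an ancestor of \<open>x\<close> and
    has a larger number than \<open>x\<close>.\<close>
  have above: "x < y" if "u (x + 1) \<le> u y" "u y < u x" for y
  proof (rule ccontr)
    assume "\<not> x < y"
    then have "y < x" using that by (cases x y rule: linorder_cases) auto
    then have "u (x + 1) < u y" using that affine_perms_inj[OF u, of "x + 1" y] by simp
    then have "v k < v y" if "y < k" "k \<le> x" for k
      using between[of y "x + 1" k] that \<open>y < x\<close> by simp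
    then have "pops_before v x y" using \<open>y < x\<close> unfolding pops_before_def by blast
    then show False using less[of x y] that by simp
  qed
  have inv: "u (inv u s) = s" for s using u by simp
  show "card ({u (x + 1)..u x} \<inter> E) \<le> card ({u (x + 1)..u x} - E)"
  \<comment> \<open>Each valley is sent to the peak on its left, the valley \<open>x + 1\<close>
    thus to \<open>x\<close> itself.\<close>
  proof (rule card_inj_on_le[where f = "\<lambda>s. u (inv u s - 1)"])
    show "inj_on (\<lambda>s. u (inv u s - 1)) ({u (x + 1)..u x} \<inter> E)"
      by (rule inj_onI) (use affine_perms_inj[OF u] inv in \<open>metis diff_add_cancel\<close>)
    show "(\<lambda>s. u (inv u s - 1)) ` ({u (x + 1)..u x} \<inter> E) \<subseteq> {u (x + 1)..u x} - E"
    proof (rule image_subsetI)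
      fix s assume s: "s \<in> {u (x + 1)..u x} \<inter> E"
      define y where "y = inv u s"
      have us: "s = u y" using inv by (simp add: y_def)
      have y: "u (x + 1) \<le> u y" "u y \<le> u x" "valley v y" using s E us by auto
      then have "y \<noteq> x" using x by auto
      then have "u y < u x" using y(2) affine_perms_inj[OF u, of y x] by simp
      then have "x < y" using above y(1) by blast
      have "u (x + 1) \<le> u (y - 1) \<and> u (y - 1) \<le> u x"
      proof (cases "y = x + 1")
        case True
        then show ?thesis using peak[OF x] by simp
      next
        case False
        then have "x + 1 < y" using \<open>x < y\<close> by simp
        moreover have "y - 1 \<noteq> x + 1" using y(3) pred[of y] succ[of x] x by metis
        ultimately have xy: "x + 1 < y - 1" by simp
        have "v k < v x" if "x < k" "k \<le> y - 1" for k
          using between[of x y k] that \<open>x < y\<close> \<open>u y < u x\<close> by simp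
        then have "u (y - 1) < u x" using xy less[of "y - 1" x] unfolding pops_before_def by auto
        moreover have "u (x + 1) < u (y - 1)" using leaf[of "x + 1" "y - 1"] succ[of x] x xy by simp
        ultimately show ?thesis by simp
      qed
      moreover have "u (y - 1) \<notin> E" using E pred y(3) by blast
      ultimately show "u (inv u s - 1) \<in> {u (x + 1)..u x} - E" by (simp add: y_def)
    qed
  qed simp
  fix t assume t: "u (x + 1) \<le> t" "t < u x"
  have "card ({u (x + 1)..t} - E) \<le> card ({u (x + 1)..t} \<inter> E - {u (x + 1)})"
  \<comment> \<open>Each peak is sent to the valley on its right, which is numbered before it. The
    valley \<open>x + 1\<close> could only come from \<open>x\<close>, whose number exceeds
    \<open>t\<close>; this makes the inequality strict.\<close>
  proof (rule card_inj_on_le[where f = "\<lambda>s. u (inv u s + 1)"])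
    show "inj_on (\<lambda>s. u (inv u s + 1)) ({u (x + 1)..t} - E)"
      by (rule inj_onI) (use affine_perms_inj[OF u] inv in \<open>metis add_right_cancel\<close>)
    show "(\<lambda>s. u (inv u s + 1)) ` ({u (x + 1)..t} - E) \<subseteq> {u (x + 1)..t} \<inter> E - {u (x + 1)}"
    proof (rule image_subsetI)
      fix s assume s: "s \<in> {u (x + 1)..t} - E"
      define z where "z = inv u s"
      have us: "s = u z" using inv by (simp add: z_def)
      have z: "u (x + 1) \<le> u z" "u z \<le> t" "\<not> valley v z" using s E us by auto
      have "x < z" using above z(1,2) t(2) by simp
      then have "u (x + 1) < u (z + 1)" using leaf[of "x + 1" "z + 1"] succ[of x] x by simp
      moreover have "u (z + 1) \<le> t" using peak[OF z(3)] z(2) by simp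
      moreover have "u (z + 1) \<in> E" using E succ z(3) by blast
      ultimately show "u (inv u s + 1) \<in> {u (x + 1)..t} \<inter> E - {u (x + 1)}" by (simp add: z_def)
    qed
  qed simp
  moreover have "u (x + 1) \<in> {u (x + 1)..t} \<inter> E" using t E succ x by auto
  then have "card ({u (x + 1)..t} \<inter> E - {u (x + 1)}) < card ({u (x + 1)..t} \<inter> E)"
    by (intro card_Diff1_less) auto
  ultimately show "card ({u (x + 1)..t} - E) < card ({u (x + 1)..t} \<inter> E)" by linarith
qed

text \<open>Valleys alternate with peaks, and a valley has no right subtree, so valleys are numbered
  from left to right. There is no first valley, and \<open>y\<close> is an arbitrary base
  point.\<close>

lemma valleys_enumeration:
  assumes n: "n \<ge> 2" and v: "v \<in> affine_perms n"
    and max: "2 * card (descents n (affine_stack_sort n v)) = n"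
  defines "u \<equiv> pi_down n v"
  obtains y where "\<And>x. valley v x \<longleftrightarrow> (\<exists>m. x = y + 2 * m)" "strict_mono (\<lambda>m. u (y + 2 * m))"
    "range (\<lambda>m. u (y + 2 * m)) = {s. affine_stack_sort n v s < affine_stack_sort n v (s - 1)}"
proof -
  note valleys = max_descents_valleys[OF n v max]
  have u: "u \<in> affine_perms n" unfolding u_def by (rule pi_down_pops_before(1)[OF n v])
  obtain y where y: "valley v y" using valleys(1)[of 0] by auto
  have two: "valley v (x + 2) \<longleftrightarrow> valley v x" for x
    using valleys(1)[of "x + 1"] valleys(1)[of x] by (simp add: algebra_simps)
  have y2: "valley v (y + 2 * m)" for m
  proof (induction m rule: int_induct[where k = 0])
    case (step1 m)
    then show ?case using two[of "y + 2 * m"] by (simp add: algebra_simps)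
  next
    case (step2 m)
    then show ?case using two[of "y + 2 * (m - 1)"] by (simp add: algebra_simps)
  qed (use y in simp)
  have val: "valley v x \<longleftrightarrow> (\<exists>m. x = y + 2 * m)" for x
  proof
    assume x: "valley v x"
    have "even (x - y)"
    proof (rule ccontr)
      assume "odd (x - y)"
      then obtain m where "x - y = 2 * m + 1" by (rule oddE)
      then have "x = y + 2 * m + 1" by simp
      then show False using x valleys(1)[of "y + 2 * m"] y2 by simp
    qed
    then obtain m where "x - y = 2 * m" by (rule evenE)
    then show "\<exists>m. x = y + 2 * m" by (intro exI[of _ m]) simp
  qed (use y2 in blast)
  have "strict_mono (\<lambda>m. u (y + 2 * m))"
  proof (rule strict_monoI)
    fix m m' :: int assume "m < m'"
    then have "pops_before v (y + 2 * m) (y + 2 * m')"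
      using y2[of m] by (auto simp: pops_before_def valley_def intro!: exI[of _ "y + 2 * m + 1"])
    then show "u (y + 2 * m) < u (y + 2 * m')" unfolding u_def using pi_down_pops_before(2)[OF n v] by blast
  qed
  moreover have "range (\<lambda>m. u (y + 2 * m)) = {s. affine_stack_sort n v s < affine_stack_sort n v (s - 1)}"
    (is "_ = ?E")
  proof
    show "range (\<lambda>m. u (y + 2 * m)) \<subseteq> ?E" using y2 valleys(2) by (auto simp: u_def)
    show "?E \<subseteq> range (\<lambda>m. u (y + 2 * m))"
    proof
      fix s assume "s \<in> ?E"
      then have "valley v (inv u s)" using valleys(2)[of "inv u s"] affine_perms_inv(1)[OF u] by (simp add: u_def)
      then obtain m where "inv u s = y + 2 * m" using val by blast
      then have "s = u (y + 2 * m)" using affine_perms_inv(1)[OF u, of s] by simp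
      then show "s \<in> range (\<lambda>m. u (y + 2 * m))" by blast
    qed
  qed
  ultimately show ?thesis using that val by blast
qed

lemma affine_stack_sort_max_descents_inj:
  assumes n: "n \<ge> 2" and v: "v \<in> affine_perms n" and v': "v' \<in> affine_perms n"
    and eq: "affine_stack_sort n v = affine_stack_sort n v'"
    and max: "2 * card (descents n (affine_stack_sort n v)) = n"
  shows "v = v'"
proof -
  define u u' where "u = pi_down n v" "u' = pi_down n v'"
  have n0: "n > 0" using n by simp
  have max': "2 * card (descents n (affine_stack_sort n v')) = n" using max eq by simp
  have u: "u \<in> affine_perms n" unfolding u_u'_def by (rule pi_down_pops_before(1)[OF n v])
  have u': "u' \<in> affine_perms n" unfolding u_u'_def by (rule pi_down_pops_before(1)[OF n v'])
  obtain y where y: "\<And>x. valley v x \<longleftrightarrow> (\<exists>m. x = y + 2 * m)" "strict_mono (\<lambda>m. u (y + 2 * m))"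
    "range (\<lambda>m. u (y + 2 * m)) = {s. affine_stack_sort n v s < affine_stack_sort n v (s - 1)}"
    using valleys_enumeration[OF n v max] unfolding u_u'_def by blast
  obtain y' where y': "\<And>x. valley v' x \<longleftrightarrow> (\<exists>m. x = y' + 2 * m)" "strict_mono (\<lambda>m. u' (y' + 2 * m))"
    "range (\<lambda>m. u' (y' + 2 * m)) = {s. affine_stack_sort n v' s < affine_stack_sort n v' (s - 1)}"
    using valleys_enumeration[OF n v' max'] unfolding u_u'_def by blast
  let ?f = "\<lambda>m. u (y + 2 * m)" and ?g = "\<lambda>m. u' (y' + 2 * m)"
  have rng: "range ?f = range ?g" unfolding y(3) y'(3) eq ..
  \<comment> \<open>Both enumerations are increasing with the same range, so the change of index is
    an increasing bijection of the integers, that is, a translation.\<close>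
  define h where "h m = inv ?g (?f m)" for m
  have gh: "?g (h m) = ?f m" for m unfolding h_def by (rule f_inv_into_f) (use rng in blast)
  have "strict_mono h"
  proof (rule strict_monoI)
    fix a b :: int assume "a < b"
    then have "?g (h a) < ?g (h b)" unfolding gh using strict_monoD[OF y(2)] by blast
    then show "h a < h b" using strict_mono_less[OF y'(2)] by blast
  qed
  moreover have "surj h"
    unfolding surj_def
  proof
    fix a
    have "?g a \<in> range ?f" unfolding rng by (rule rangeI)
    then obtain b where "?g a = ?f b" by (rule rangeE)
    then have "?g (h b) = ?g a" using gh by simp
    then have "h b = a" using strict_mono_eq[OF y'(2)] by blast
    then show "\<exists>b. a = h b" by blast
  qed
  ultimately obtain c where c: "\<And>m. h m = m + c" using strict_mono_int_translation by blast
  define d where "d = y' + 2 * c - y"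
  have valley_d: "valley v' (x + d) \<longleftrightarrow> valley v x" for x
  proof -
    have "(\<exists>m. x + d = y' + 2 * m) \<longleftrightarrow> (\<exists>m. x = y + 2 * m)"
    proof safe
      fix m assume "x + d = y' + 2 * m"
      then show "\<exists>m. x = y + 2 * m" by (intro exI[of _ "m - c"]) (simp add: d_def algebra_simps)
    next
      fix m
      show "\<exists>m'. y + 2 * m + d = y' + 2 * m'" by (intro exI[of _ "m + c"]) (simp add: d_def)
    qed
    then show ?thesis using y(1) y'(1) by simp
  qed
  have u_valley: "u' (x + d) = u x" if x: "valley v x" for x
  proof -
    obtain m where m: "x = y + 2 * m" using x y(1) by blast
    then have "x + d = y' + 2 * h m" using c by (simp add: d_def)
    then show ?thesis using gh[of m] m by simp
  qed
  have u_eq: "u' (x + d) = u x" for x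
  proof (cases "valley v x")
    case False
    have x': "\<not> valley v' (x + d)" using valley_d False by simp
    have "valley v (x + 1)" using max_descents_valleys(1)[OF n v max] False by simp
    then have start: "u' (x + d + 1) = u (x + 1)" using u_valley[of "x + 1"] by (simp add: algebra_simps)
    have less: "u (x + 1) < u x" "u' (x + d + 1) < u' (x + d)"
      using max_descents_valleys(1)[OF n v max, of x] max_descents_valleys(1)[OF n v' max', of "x + d"] False x'
        pi_down_right_child[OF n v, of x] pi_down_right_child[OF n v', of "x + d"]
      by (simp_all add: u_u'_def valley_def)
    \<comment> \<open>If one of the two numbers were smaller, the strict excess of openings in one
      preimage would contradict the balance reached at that number in the other.\<close>
    show ?thesis
      using ballot(1)[OF n v max False] ballot(1)[OF n v' max' x']
        ballot(2)[OF n v max False, of "u' (x + d)"] ballot(2)[OF n v' max' x', of "u x"] start eq less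
      unfolding u_u'_def[symmetric] by (cases "u x" "u' (x + d)" rule: linorder_cases) auto
  qed (use u_valley in blast)
  \<comment> \<open>The displacement of \<open>u'\<close> also sums to zero over the period
    translated by \<open>d\<close>. In terms of \<open>u\<close> this sum is its own zero sum minus
    \<open>n * d\<close>.\<close>
  have "(\<Sum>i=1..int n. u' (i + d) - (i + d)) = 0"
    by (rule sum_displacement[OF n0 u']) (auto simp: inj_def)
  then have "(\<Sum>i=1..int n. u i - i) - int n * d = 0"
    by (simp add: u_eq sum_subtractf sum.distrib algebra_simps)
  then have "d = 0" using affine_perms_sum[OF u] n0 by simp
  then have "u = u'" using u_eq by auto
  show ?thesis
  proof
    fix x
    have "v x = affine_stack_sort n v (u x)"
      using affine_stack_sort_pi_down[OF n v] by (simp add: u_u'_def)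
    also have "\<dots> = affine_stack_sort n v' (u' x)" using eq \<open>u = u'\<close> by simp
    also have "\<dots> = v' x" using affine_stack_sort_pi_down[OF n v'] by (simp add: u_u'_def)
    finally show "v x = v' x" .
  qed
qed

lemma uniquely_sorted_iff:
  assumes n: "n \<ge> 2" and w: "w \<in> affine_perms n"
  shows "uniquely_sorted n w \<longleftrightarrow>
    w \<in> affine_stack_sort n ` affine_perms n \<and> 2 * card (descents n w) = n"
proof
  assume "uniquely_sorted n w"
  then obtain v where v: "{v \<in> affine_perms n. affine_stack_sort n v = w} = {v}"
    by (auto simp: uniquely_sorted_def fertility_def card_1_singleton_iff)
  then have "v \<in> affine_perms n" "affine_stack_sort n v = w" by auto
  moreover from this have "2 * card (descents n (affine_stack_sort n v)) = n"
    by (intro unique_preimage_valleys[OF n]) (use v in auto)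
  ultimately show "w \<in> affine_stack_sort n ` affine_perms n \<and> 2 * card (descents n w) = n" by blast
next
  assume *: "w \<in> affine_stack_sort n ` affine_perms n \<and> 2 * card (descents n w) = n"
  then obtain v where v: "v \<in> affine_perms n" "w = affine_stack_sort n v" by blast
  have "x = v" if "x \<in> affine_perms n" "affine_stack_sort n x = w" for x
    using affine_stack_sort_max_descents_inj[OF n that(1) v(1)] that v(2) * by simp
  then have "{v \<in> affine_perms n. affine_stack_sort n v = w} = {v}" using v by auto
  then show "uniquely_sorted n w" by (simp add: uniquely_sorted_def fertility_def)
qed

theorem theorem8p14:
  fixes n :: nat
  assumes "n \<ge> 2"
  shows "(\<forall>w \<in> affine_perms n. uniquely_sorted n w \<longleftrightarrow>
            w \<in> affine_stack_sort n ` affine_perms n \<and>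
            real (card (descents n w)) = real n / 2) \<and>
         (odd n \<longrightarrow> \<not> (\<exists>w \<in> affine_perms n. uniquely_sorted n w))"
proof -
  have "real (card (descents n w)) = real n / 2 \<longleftrightarrow> 2 * card (descents n w) = n" for w
    by (simp add: field_simps) linarith
  moreover have "even n" if "2 * card (descents n w) = n" for w
    using that by (metis dvd_triv_left)
  ultimately show ?thesis using uniquely_sorted_iff[OF assms] by blast
qed

end
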